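(* Let $(\Omega,d)$ be a compact metric space of diameter $1$, let $T:\Omega\to\Omega$ be topologically mixing and $J:\Omega\to(0,\infty)$. Assume that either (i) $T$ is Ruelle expanding and $\log J$ is $\omega_{0,\beta\log}$-Hölder continuous for some $\beta>1$ (put $\gamma=\beta-1$), or (ii) $T$ is Ruelle expansive with contraction rate $t(1+nt^{1/\beta})^{-\beta}$ for some $\beta>1$ and $\log J$ is $\omega_{\alpha,0\log}$-Hölder with $\alpha\beta>1$ (put $\gamma=\alpha\beta-1$); thus $\gamma>0$. Then the pressure function $s\mapsto P(s)$ is differentiable and $$\frac{dP(s)}{ds}=\int\log J\,d\mu_s .$$
   Context: Ruelle expansive: let $r>0$ and let $c_n:[0,1]\to[0,\infty)$ be functions with $c_n(0)=0$, $t\mapsto c_n(t)$ strictly increasing, $n\mapsto c_n(t)$ decreasing and $\lim_n c_n(t)=0$. $T$ is Ruelle expansive with contraction rate $c_n$ (understood up to a multiplicative constant) if for all $n\in\mathbb{N}=\{1,2,\dots\}$ and $x,y,\tilde x\in\Omega$ with $d(x,y)<r$ and $T^n(\tilde x)=x$ there is a unique $\tilde y$ with $T^n(\tilde y)=y$ and $d(T^k\tilde x,T^k\tilde y)\le c_{n-k}(d(x,y))$ for $k=0,\dots,n$. Ruelle expanding: there are $\lambda\in(0,1)$, $r>0$ such that for all $x,y,\tilde x$ with $d(x,y)<r$, $T(\tilde x)=x$ there is a unique $\tilde y$ with $T(\tilde y)=y$, $d(\tilde x,\tilde y)<\lambda r$, and furthermore $d(\tilde x,\tilde y)\le\lambda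 d(x,y)$. Throughout, $T$ and its iterates are local homeomorphisms. Topologically mixing: for all nonempty open $U,V$ there is $k$ with $T^{-n}(U)\cap V\ne\emptyset$ for all $n>k$. $\omega_{\alpha,\beta\log}(t)=t^\alpha(\log t_0-\log t)^{-\beta}$, $t_0>1$ chosen such that this is concave on $[0,1]$; $f$ is $\omega$-Hölder if $|f(x)-f(y)|\le C_f\omega(d(x,y))$ for all $x,y$. $\mathcal{L}_{b}(f)(x)=\sum_{T(y)=x}e^{b(y)}f(y)$. For $s\in\mathbb{R}$, $P(s)=\lim_n\frac1n\log\mathcal{L}^n_{s\log J}(\mathbf 1)(z_0)$ (exists and is independent of $z_0\in\Omega$). $m_s$ is the unique Borel probability measure with $\int\mathcal{L}_{s\log J}(f)\,dm_s=e^{P(s)}\int f\,dm_s$ for all continuous $f$; $h_s$ is the unique strictly positive continuous function with $\mathcal{L}_{s\log J}(h_s)=e^{P(s)}h_s$ and $\int h_s\,dm_s=1$; $d\mu_s=h_s\,dm_s$. *)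

theory Defs
  imports "HOL-Probability.Probability"
begin

text \<open>The compact metric space \<open>\<Omega>\<close> is rendered as a type \<open>'a :: metric_space\<close> with
  \<open>compact UNIV\<close>. As the type is arbitrary, this covers every nonempty compact metric space.\<close>

definition local_homeomorphism :: "('a::topological_space \<Rightarrow> 'b::topological_space) \<Rightarrow> bool" where
  "local_homeomorphism f \<longleftrightarrow>
     (\<forall>x. \<exists>U g. open U \<and> x \<in> U \<and> open (f ` U) \<and> homeomorphism U (f ` U) f g)"

definition topologically_mixing :: "('a::topological_space \<Rightarrow> 'a) \<Rightarrow> bool" where
  "topologically_mixing T \<longleftrightarrow>
     (\<forall>U V. open U \<and> U \<noteq> {} \<and> open V \<and> V \<noteq> {} \<longrightarrow>
        (\<exists>k. \<forall>n>k. (T ^^ n) -` U \<inter> V \<noteq> {}))"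

definition ruelle_expanding :: "('a::metric_space \<Rightarrow> 'a) \<Rightarrow> bool" where
  "ruelle_expanding T \<longleftrightarrow>
     (\<exists>l r::real. 0 < l \<and> l < 1 \<and> 0 < r \<and>
        (\<forall>x y x'. dist x y < r \<and> T x' = x \<longrightarrow>
           (\<exists>!y'. T y' = y \<and> dist x' y' < l * r) \<and>
           (\<forall>y'. T y' = y \<and> dist x' y' < l * r \<longrightarrow> dist x' y' \<le> l * dist x y)))"

text \<open>Only the values of \<open>c n\<close> on \<open>{0..1}\<close> are relevant; there, nonnegativity follows from
  \<open>c n 0 = 0\<close> and strict monotonicity. The index starts at \<open>0\<close>, since \<open>c 0\<close> occurs in the
  definition of Ruelle expansiveness (for \<open>k = n\<close>).\<close>

definition contraction_rate :: "(nat \<Rightarrow> real \<Rightarrow> real) \<Rightarrow> bool" where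
  "contraction_rate c \<longleftrightarrow>
     (\<forall>n. c n 0 = 0 \<and> strict_mono_on {0..1} (c n)) \<and>
     (\<forall>t\<in>{0..1}. antimono (\<lambda>n. c n t) \<and> (\<lambda>n. c n t) \<longlonglongrightarrow> 0)"

definition ruelle_expansive_exact :: "('a::metric_space \<Rightarrow> 'a) \<Rightarrow> (nat \<Rightarrow> real \<Rightarrow> real) \<Rightarrow> bool" where
  "ruelle_expansive_exact T c \<longleftrightarrow> contraction_rate c \<and>
     (\<exists>r>0. \<forall>n\<ge>1. \<forall>x y x'. dist x y < r \<and> (T ^^ n) x' = x \<longrightarrow>
        (\<exists>!y'. (T ^^ n) y' = y \<and>
           (\<forall>k\<le>n. dist ((T ^^ k) x') ((T ^^ k) y') \<le> c (n - k) (dist x y))))"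

text \<open>Contraction rates are understood up to a multiplicative constant.\<close>

definition ruelle_expansive :: "('a::metric_space \<Rightarrow> 'a) \<Rightarrow> (nat \<Rightarrow> real \<Rightarrow> real) \<Rightarrow> bool" where
  "ruelle_expansive T c \<longleftrightarrow> (\<exists>C>0. ruelle_expansive_exact T (\<lambda>n t. C * c n t))"

text \<open>The modulus \<open>\<omega>\<^bsub>\<alpha>,\<beta>log\<^esub>\<close>; at \<open>t = 0\<close> it takes the value of its limit, \<open>0\<close>
  (\<open>0 powr \<alpha> = 0\<close> even for \<open>\<alpha> = 0\<close>, whereas \<open>t powr 0 = 1\<close> for \<open>t > 0\<close>).\<close>

definition omega_log :: "real \<Rightarrow> real \<Rightarrow> real \<Rightarrow> real \<Rightarrow> real" where
  "omega_log t0 \<alpha> \<beta> t = t powr \<alpha> * (ln t0 - ln t) powr (- \<beta>)"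

text \<open>\<open>t0\<close> is an admissible choice of the constant in the modulus.\<close>

definition admissible_t0 :: "real \<Rightarrow> real \<Rightarrow> real \<Rightarrow> bool" where
  "admissible_t0 t0 \<alpha> \<beta> \<longleftrightarrow> t0 > 1 \<and> concave_on {0..1} (omega_log t0 \<alpha> \<beta>)"

definition omega_hoelder :: "(real \<Rightarrow> real) \<Rightarrow> ('a::metric_space \<Rightarrow> real) \<Rightarrow> bool" where
  "omega_hoelder \<omega> f \<longleftrightarrow> (\<exists>C. \<forall>x y. \<bar>f x - f y\<bar> \<le> C * \<omega> (dist x y))"

text \<open>The sum is over a finite set whenever \<open>T\<close> is a local homeomorphism of a compact space.\<close>

definition transfer_op :: "('a \<Rightarrow> 'a) \<Rightarrow> ('a \<Rightarrow> real) \<Rightarrow> ('a \<Rightarrow> real) \<Rightarrow> 'a \<Rightarrow> real" where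
  "transfer_op T b f x = (\<Sum>y\<in>{y. T y = x}. exp (b y) * f y)"

abbreviation transfer_J :: "('a \<Rightarrow> 'a) \<Rightarrow> ('a \<Rightarrow> real) \<Rightarrow> real \<Rightarrow> ('a \<Rightarrow> real) \<Rightarrow> 'a \<Rightarrow> real" where
  "transfer_J T J s \<equiv> transfer_op T (\<lambda>y. s * ln (J y))"

definition pressure :: "('a \<Rightarrow> 'a) \<Rightarrow> ('a \<Rightarrow> real) \<Rightarrow> real \<Rightarrow> real" where
  "pressure T J s =
     (THE p. \<forall>z. (\<lambda>n. 1 / real n * ln ((transfer_J T J s ^^ n) (\<lambda>_. 1) z)) \<longlonglongrightarrow> p)"

definition eigenmeasure :: "('a::topological_space \<Rightarrow> 'a) \<Rightarrow> ('a \<Rightarrow> real) \<Rightarrow> real \<Rightarrow> 'a measure" where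
  "eigenmeasure T J s =
     (THE m. prob_space m \<and> sets m = sets borel \<and>
        (\<forall>f::'a \<Rightarrow> real. continuous_on UNIV f \<longrightarrow>
           (\<integral>x. transfer_J T J s f x \<partial>m) = exp (pressure T J s) * (\<integral>x. f x \<partial>m)))"

definition eigenfunction :: "('a::topological_space \<Rightarrow> 'a) \<Rightarrow> ('a \<Rightarrow> real) \<Rightarrow> real \<Rightarrow> 'a \<Rightarrow> real" where
  "eigenfunction T J s =
     (THE h. continuous_on UNIV h \<and> (\<forall>x. 0 < h x) \<and>
        (\<forall>x. transfer_J T J s h x = exp (pressure T J s) * h x) \<and>
        (\<integral>x. h x \<partial>(eigenmeasure T J s)) = 1)"

definition equilibrium_measure :: "('a::topological_space \<Rightarrow> 'a) \<Rightarrow> ('a \<Rightarrow> real) \<Rightarrow> real \<Rightarrow> 'a measure" where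
  "equilibrium_measure T J s =
     density (eigenmeasure T J s) (\<lambda>x. ennreal (eigenfunction T J s x))"

end

(* The pressure is the logarithm of the leading eigenvalue of the transfer operator L_s, and
   differentiating L_s h_s = ev_s h_s against the eigenmeasure at a nearby parameter t gives
   (ev_t - ev_s) m_t(h_s) = m_t(L_t h_s - L_s h_s); dividing by t - s and using only weak continuity of
   m_t one gets ev' = ev_s m_s(h_s log J).

   The spectral data are obtained without fixed point theorems from the averages
   R_n f = L^n f / L^n 1. Bounded distortion makes them equicontinuous, mixing makes every fibre of some
   iterate dense enough to contract their oscillation, so R_n f converges uniformly to a constant
   Lambda f, uniformly over bounded equicontinuous families. Lambda is the eigenmeasure, the eigenvalue is
   Lambda (L 1), and L^n 1 / ev^n is Cauchy because its ratios are values of R_n on such a family. *)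

theory Submission
  imports Defs
begin

section \<open>Riesz representation on compact metric spaces\<close>

text \<open>The potential is only controlled by a summable modulus along orbits, and inverse
  branches may contract at a merely polynomial rate, so there is no spectral gap to start from and
  no analytic perturbation theory at hand. Every limit is therefore taken without a rate. Both cases
  of the theorem enter through one fact: along matched orbits ending at distance t, the potential
  varies by at most a constant times a tail of the series of j^(-p) with p = \<gamma> + 1, and the
  tail starts later as t tends to 0. This is where \<gamma> > 0 is spent; it makes the distortion
  bound uniform in n.

  The pressure, the eigenmeasure and the eigenfunction are definite descriptions, the later ones
  mentioning the earlier, so each has to be shown to exist and to be unique. Convergence of the
  averages yields only a positive functional: a Riesz representation turns it into a Borel measure,
  and uniqueness uses that Borel probability measures are determined by their integrals of
  continuous functions.\<close>

lemma infdist_cutoff_tendsto: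
  fixes U :: "'a::metric_space set"
  assumes "open U" "U \<noteq> UNIV"
  shows "(\<lambda>n. min 1 (real n * infdist x (- U))) \<longlonglongrightarrow> indicator U x"
proof (cases "x \<in> U")
  case True
  \<comment> \<open>The complement of \<open>U\<close> is closed and nonempty. For
    \<open>U = UNIV\<close> the claim would fail, since \<open>infdist\<close> to the empty set is 0
    by convention.\<close>
  have "infdist x (- U) > 0"
    using True assms in_closed_iff_infdist_zero[of "- U" x] infdist_nonneg[of x "- U"]
    by (force simp: closed_def)
  then obtain n0 where n0: "1 < real n0 * infdist x (- U)" using reals_Archimedean3 by blast
  have "min 1 (real n * infdist x (- U)) = 1" if "n \<ge> n0" for n
  proof -
    have "real n0 * infdist x (- U) \<le> real n * infdist x (- U)"
      using that by (intro mult_right_mono) (auto simp: infdist_nonneg)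
    thus ?thesis using n0 by simp
  qed
  thus ?thesis using True by (intro tendsto_eventually) (auto simp: eventually_sequentially)
qed simp

text \<open>The functional is constrained on continuous functions only and may be arbitrary
  elsewhere, as befits one that is defined by a \<open>lim\<close>.\<close>

locale positive_functional =
  fixes \<Lambda> :: "('a::metric_space \<Rightarrow> real) \<Rightarrow> real"
  assumes compact_space: "compact (UNIV :: 'a set)"
    and add: "continuous_on UNIV f \<Longrightarrow> continuous_on UNIV g \<Longrightarrow> \<Lambda> (\<lambda>x. f x + g x) = \<Lambda> f + \<Lambda> g"
    and scale: "continuous_on UNIV f \<Longrightarrow> \<Lambda> (\<lambda>x. c * f x) = c * \<Lambda> f"
    and nonneg: "continuous_on UNIV f \<Longrightarrow> (\<And>x. 0 \<le> f x) \<Longrightarrow> 0 \<le> \<Lambda> f"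
    and one: "\<Lambda> (\<lambda>_. 1) = 1"
begin

lemma zero: "\<Lambda> (\<lambda>_. 0) = 0"
  using scale[of "\<lambda>_. 0" 0] by simp

lemma const: "\<Lambda> (\<lambda>_. c) = c"
  using scale[of "\<lambda>_. 1" c] by (simp add: one)

lemma diff:
  assumes "continuous_on UNIV f" "continuous_on UNIV g"
  shows "\<Lambda> (\<lambda>x. f x - g x) = \<Lambda> f - \<Lambda> g"
proof -
  have "continuous_on UNIV (\<lambda>x. f x - g x)" using assms by (intro continuous_intros)
  from add[OF this assms(2)] show ?thesis by simp
qed

lemma mono:
  assumes "continuous_on UNIV f" "continuous_on UNIV g" "\<And>x. f x \<le> g x"
  shows "\<Lambda> f \<le> \<Lambda> g"
proof -
  have "0 \<le> \<Lambda> (\<lambda>x. g x - f x)" using assms by (intro nonneg continuous_intros) auto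
  thus ?thesis using assms diff by simp
qed

lemma sum:
  assumes "finite I" "\<And>i. i \<in> I \<Longrightarrow> continuous_on UNIV (f i)"
  shows "\<Lambda> (\<lambda>x. \<Sum>i\<in>I. f i x) = (\<Sum>i\<in>I. \<Lambda> (f i))"
  using assms
proof (induction I rule: finite_induct)
  case empty thus ?case by (simp add: zero)
next
  case (insert i I)
  thus ?case using add[of "f i" "\<lambda>x. \<Sum>i\<in>I. f i x"] by (simp add: continuous_on_sum)
qed

lemma abs_le:
  assumes "continuous_on UNIV f" "\<And>x. \<bar>f x\<bar> \<le> B"
  shows "\<bar>\<Lambda> f\<bar> \<le> B"
proof -
  have "\<Lambda> f \<le> \<Lambda> (\<lambda>_. B)"
    using assms(2) by (intro mono assms(1) continuous_on_const) (metis abs_le_D1)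
  moreover have "-B \<le> f x" for x using assms(2)[of x] by linarith
  hence "\<Lambda> (\<lambda>_. -B) \<le> \<Lambda> f"
    by (intro mono assms(1) continuous_on_const)
  ultimately show ?thesis by (simp add: const)
qed

section \<open>The outer measure generated by a positive functional\<close>

definition covers :: "'a set \<Rightarrow> (nat \<Rightarrow> 'a \<Rightarrow> real) set" where
  "covers A = {F. (\<forall>i. continuous_on UNIV (F i) \<and> (\<forall>x. 0 \<le> F i x)) \<and>
                  (\<forall>x\<in>A. 1 \<le> (\<Sum>i. ennreal (F i x)))}"

text \<open>Daniell's construction: sets are covered by countable sums of nonnegative continuous
  functions instead of by open sets. The functional can then be applied to a cover directly, and
  splitting a set amounts to splitting functions.\<close>

definition outer :: "'a set \<Rightarrow> ennreal" where
  "outer A = (INF F\<in>covers A. \<Sum>i. ennreal (\<Lambda> (F i)))"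

lemma outer_le_cover: "F \<in> covers A \<Longrightarrow> outer A \<le> (\<Sum>i. ennreal (\<Lambda> (F i)))"
  unfolding outer_def by (rule INF_lower)

lemma outer_le_fun:
  assumes "continuous_on UNIV f" "\<And>x. 0 \<le> f x" "\<And>x. x \<in> A \<Longrightarrow> 1 \<le> f x"
  shows "outer A \<le> ennreal (\<Lambda> f)"
proof -
  define F where "F = (\<lambda>i::nat. if i = 0 then f else (\<lambda>_. 0))"
  have 1: "(\<Sum>i. ennreal (F i x)) = ennreal (f x)" for x
    by (subst suminf_finite[of "{0}"]) (auto simp: F_def)
  have "F \<in> covers A" unfolding covers_def using assms by (auto simp: 1) (auto simp: F_def)
  hence "outer A \<le> (\<Sum>i. ennreal (\<Lambda> (F i)))" by (rule outer_le_cover)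
  also have "\<dots> = ennreal (\<Lambda> f)"
    by (subst suminf_finite[of "{0}"]) (auto simp: F_def zero)
  finally show ?thesis .
qed

text \<open>Covers are singly indexed, so a double family is flattened by
  \<open>prod_decode\<close>; nonnegativity makes the order of summation immaterial.\<close>

lemma outer_le_double:
  assumes "\<And>m n. continuous_on UNIV (F m n)" "\<And>m n x. 0 \<le> F m n x"
    and "\<And>x. x \<in> A \<Longrightarrow> 1 \<le> (\<Sum>m. \<Sum>n. ennreal (F m n x))"
  shows "outer A \<le> (\<Sum>m. \<Sum>n. ennreal (\<Lambda> (F m n)))"
proof -
  define G where "G = (\<lambda>i. case prod_decode i of (m, n) \<Rightarrow> F m n)"
  have 1: "(\<Sum>i. ennreal (G i x)) = (\<Sum>m. \<Sum>n. ennreal (F m n x))" for x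
    using suminf_ennreal_2dimen[of "\<lambda>m. \<Sum>n. ennreal (F m n x)" "\<lambda>(m,n). ennreal (F m n x)"]
    by (simp add: G_def case_prod_beta)
  have 2: "(\<Sum>i. ennreal (\<Lambda> (G i))) = (\<Sum>m. \<Sum>n. ennreal (\<Lambda> (F m n)))"
    using suminf_ennreal_2dimen[of "\<lambda>m. \<Sum>n. ennreal (\<Lambda> (F m n))" "\<lambda>(m,n). ennreal (\<Lambda> (F m n))"]
    by (simp add: G_def case_prod_beta)
  have "G \<in> covers A" unfolding covers_def using assms
    by (auto simp: 1) (auto simp: G_def split: prod.split)
  thus ?thesis using outer_le_cover[of G A] 2 by simp
qed

lemma outer_close:
  assumes "outer A < top" "0 < e"
  shows "\<exists>F\<in>covers A. (\<Sum>i. ennreal (\<Lambda> (F i))) \<le> outer A + ennreal e"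
proof -
  have "outer A < outer A + ennreal e" using assms by (auto simp: less_top)
  hence "\<exists>F\<in>covers A. (\<Sum>i. ennreal (\<Lambda> (F i))) < outer A + ennreal e"
    unfolding outer_def INF_less_iff .
  thus ?thesis by (meson less_imp_le)
qed

lemma outer_mono: "A \<subseteq> B \<Longrightarrow> outer A \<le> outer B"
  unfolding outer_def by (rule INF_superset_mono) (auto simp: covers_def)

lemma outer_le_1: "outer A \<le> 1"
  using outer_le_fun[of "\<lambda>_. 1" A] by (simp add: one)

lemma outer_less_top: "outer A < top"
  using outer_le_1[of A] by (rule le_less_trans) simp

lemma outer_empty: "outer {} = 0"
  using outer_le_fun[of "\<lambda>_. 0" "{}"] by (simp add: zero)

lemma outer_subadditive: "outer (\<Union>m. A m) \<le> (\<Sum>m. outer (A m))"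
proof (rule ennreal_le_epsilon)
  fix e :: real assume e: "0 < e"
  have "\<exists>F\<in>covers (A m). (\<Sum>i. ennreal (\<Lambda> (F i))) \<le> outer (A m) + ennreal (e * (1/2) ^ Suc m)" for m
    using e by (intro outer_close outer_less_top) simp
  then obtain F where F: "\<And>m. F m \<in> covers (A m)"
    "\<And>m. (\<Sum>i. ennreal (\<Lambda> (F m i))) \<le> outer (A m) + ennreal (e * (1/2) ^ Suc m)"
    by metis
  have "outer (\<Union>m. A m) \<le> (\<Sum>m. \<Sum>i. ennreal (\<Lambda> (F m i)))"
  proof (rule outer_le_double)
    fix x assume "x \<in> (\<Union>m. A m)"
    then obtain m where "x \<in> A m" by auto
    hence "1 \<le> (\<Sum>i. ennreal (F m i x))" using F(1)[of m] by (auto simp: covers_def)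
    also have "\<dots> \<le> (\<Sum>m. \<Sum>i. ennreal (F m i x))"
      using sum_le_suminf[of "\<lambda>m. \<Sum>i. ennreal (F m i x)" "{m}"] by simp
    finally show "1 \<le> (\<Sum>m. \<Sum>i. ennreal (F m i x))" .
  qed (use F(1) in \<open>auto simp: covers_def\<close>)
  also have "\<dots> \<le> (\<Sum>m. outer (A m) + ennreal (e * (1/2) ^ Suc m))"
    by (intro suminf_le F(2)) auto
  also have "\<dots> = (\<Sum>m. outer (A m)) + (\<Sum>m. ennreal (e * (1/2) ^ Suc m))"
    by (simp add: suminf_add)
  also have "(\<Sum>m. ennreal (e * (1/2) ^ Suc m)) = ennreal e"
    using e sums_mult[OF power_half_series, of e] by (intro suminf_ennreal_eq) auto
  finally show "outer (\<Union>m. A m) \<le> (\<Sum>m. outer (A m)) + ennreal e" .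
qed

lemma outer_measure_space_outer: "outer_measure_space UNIV outer"
  unfolding outer_measure_space_def positive_def increasing_def countably_subadditive_def
  using outer_empty outer_mono outer_subadditive by auto

lemma outer_Un: "outer (A \<union> B) \<le> outer A + outer B"
proof -
  interpret algebra UNIV "UNIV::'a set set" by (simp add: algebra_iff_Un)
  have "subadditive UNIV outer"
    using outer_measure_space_outer countably_subadditive_subadditive
    unfolding outer_measure_space_def by blast
  hence "outer (A \<union> (B - A)) \<le> outer A + outer (B - A)" unfolding subadditive_def by blast
  also have "\<dots> \<le> outer A + outer B" by (intro add_mono outer_mono order_refl) auto
  finally show ?thesis by simp
qed

text \<open>The cutoffs \<open>e n\<close> increase to the indicator of \<open>U\<close>. A cover of \<open>A\<close> splits into
  \<open>F i * (1 - e N)\<close>, covering \<open>A - U\<close>, and the telescoping pieces \<open>F i * (e (n + 1) - e n)\<close>,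
  covering \<open>A \<inter> U\<close>.\<close>

lemma outer_open_split:
  assumes "open U" "U \<noteq> UNIV"
  shows "outer (A \<inter> U) + outer (A - U) \<le> outer A"
proof (rule ennreal_le_epsilon)
  fix \<epsilon> :: real assume "0 < \<epsilon>"
  then obtain F where F: "F \<in> covers A" "(\<Sum>i. ennreal (\<Lambda> (F i))) \<le> outer A + ennreal \<epsilon>"
    using outer_close[OF outer_less_top] by blast
  have Fc: "continuous_on UNIV (F i)" and F0: "0 \<le> F i x" for i x using F(1) by (auto simp: covers_def)
  define e where "e = (\<lambda>(n::nat) x. min 1 (real n * infdist x (-U)))"
  have ec: "continuous_on UNIV (e n)" for n
    unfolding e_def by (intro continuous_intros)
  have e01: "0 \<le> e n x" "e n x \<le> 1" for n x unfolding e_def by (auto simp: infdist_nonneg)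
  have einc: "e n x \<le> e (Suc n) x" for n x
    unfolding e_def by (intro min.mono mult_right_mono) (auto simp: infdist_nonneg)
  have e0: "e 0 x = 0" for x by (simp add: e_def)
  have eU: "e n x = 0" if "x \<notin> U" for n x using that by (simp add: e_def)
  have elim: "(\<lambda>n. e n x) \<longlonglongrightarrow> 1" if "x \<in> U" for x
    using infdist_cutoff_tendsto[OF assms, of x] that unfolding e_def by simp
  define G where "G = (\<lambda>i n x. F i x * (e (Suc n) x - e n x))"
  define H where "H = (\<lambda>N i x. F i x * (1 - e N x))"
  have Gc: "continuous_on UNIV (G i n)" for i n unfolding G_def by (intro continuous_intros Fc ec)
  have G0: "0 \<le> G i n x" for i n x unfolding G_def using F0 einc by simp
  have Hc: "continuous_on UNIV (H N i)" for i N unfolding H_def by (intro continuous_intros Fc ec)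
  have H0: "0 \<le> H N i x" for i N x unfolding H_def using F0 e01 by simp
  have "outer (A \<inter> U) \<le> (\<Sum>i. \<Sum>n. ennreal (\<Lambda> (G i n)))"
  proof (rule outer_le_double[OF Gc G0])
    fix x assume x: "x \<in> A \<inter> U"
    have "(\<lambda>n. F i x * (e (Suc n) x - e n x)) sums (F i x * (1 - 0))" for i
      using telescope_sums[OF elim[of x]] x by (intro sums_mult) (auto simp: e0)
    hence "(\<Sum>n. ennreal (G i n x)) = ennreal (F i x)" for i
      using G0 unfolding G_def by (intro suminf_ennreal_eq) auto
    thus "1 \<le> (\<Sum>i. \<Sum>n. ennreal (G i n x))" using x F(1) by (auto simp: covers_def)
  qed
  \<comment> \<open>The supremum over \<open>N\<close> is moved outside the sum over
    \<open>i\<close>, so that one \<open>N\<close> at a time can be treated: the first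
    \<open>N\<close> telescoping pieces of \<open>F i\<close> and the remainder \<open>H N i\<close>
    add up exactly to \<open>F i\<close>.\<close>
  also have "\<dots> = (\<Sum>i. SUP N. \<Sum>n<N. ennreal (\<Lambda> (G i n)))" by (simp add: suminf_eq_SUP)
  also have "\<dots> = (SUP N. \<Sum>i. \<Sum>n<N. ennreal (\<Lambda> (G i n)))"
    by (intro ennreal_suminf_SUP_eq) (auto simp: incseq_Suc_iff)
  finally have 1: "outer (A \<inter> U) \<le> (SUP N. \<Sum>i. \<Sum>n<N. ennreal (\<Lambda> (G i n)))" .
  have "outer (A \<inter> U) + outer (A - U) \<le> (SUP N. \<Sum>i. \<Sum>n<N. ennreal (\<Lambda> (G i n))) + outer (A - U)"
    by (intro add_mono 1 order_refl)
  also have "\<dots> = (SUP N. (\<Sum>i. \<Sum>n<N. ennreal (\<Lambda> (G i n))) + outer (A - U))"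
    by (simp add: ennreal_SUP_add_left)
  also have "\<dots> \<le> (\<Sum>i. ennreal (\<Lambda> (F i)))"
  proof (rule SUP_least)
    fix N
    have "H N \<in> covers (A - U)" unfolding covers_def
      using Hc H0 F(1) by (auto simp: H_def eU covers_def)
    hence "outer (A - U) \<le> (\<Sum>i. ennreal (\<Lambda> (H N i)))" by (rule outer_le_cover)
    hence "(\<Sum>i. \<Sum>n<N. ennreal (\<Lambda> (G i n))) + outer (A - U) \<le>
      (\<Sum>i. \<Sum>n<N. ennreal (\<Lambda> (G i n))) + (\<Sum>i. ennreal (\<Lambda> (H N i)))"
      by (intro add_mono order_refl)
    also have "\<dots> = (\<Sum>i. (\<Sum>n<N. ennreal (\<Lambda> (G i n))) + ennreal (\<Lambda> (H N i)))"
      by (simp add: suminf_add)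
    also have "(\<lambda>i. (\<Sum>n<N. ennreal (\<Lambda> (G i n))) + ennreal (\<Lambda> (H N i))) = (\<lambda>i. ennreal (\<Lambda> (F i)))"
    proof
      fix i
      have eq: "F i x = (\<Sum>n<N. G i n x) + H N i x" for x
        unfolding G_def H_def sum_distrib_left[symmetric]
        using sum_lessThan_telescope[of "\<lambda>n. e n x" N] by (simp add: e0 algebra_simps)
      have "\<Lambda> (F i) = \<Lambda> (\<lambda>x. (\<Sum>n<N. G i n x) + H N i x)" using eq by presburger
      also have "\<dots> = (\<Sum>n<N. \<Lambda> (G i n)) + \<Lambda> (H N i)"
        by (subst add) (auto intro!: continuous_intros Gc Hc simp: sum[OF _ Gc])
      finally show "(\<Sum>n<N. ennreal (\<Lambda> (G i n))) + ennreal (\<Lambda> (H N i)) = ennreal (\<Lambda> (F i))"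
        by (simp add: sum_ennreal nonneg Gc G0 Hc H0 ennreal_plus[symmetric] sum_nonneg del: ennreal_plus)
    qed
    finally show "(\<Sum>i. \<Sum>n<N. ennreal (\<Lambda> (G i n))) + outer (A - U) \<le> (\<Sum>i. ennreal (\<Lambda> (F i)))" .
  qed
  also have "\<dots> \<le> outer A + ennreal \<epsilon>" by (rule F)
  finally show "outer (A \<inter> U) + outer (A - U) \<le> outer A + ennreal \<epsilon>" .
qed

text \<open>Caratheodory's criterion: one inequality is subadditivity, the other is
  \<open>outer_open_split\<close>. The whole space is treated apart because the cutoffs degenerate
  there.\<close>

lemma open_in_lambda_system:
  assumes "open U"
  shows "U \<in> lambda_system UNIV UNIV outer"
proof -
  have "outer (U \<inter> A) + outer ((UNIV - U) \<inter> A) = outer A" for A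
  proof (cases "U = UNIV")
    case True thus ?thesis by (simp add: outer_empty)
  next
    case False
    have "A = (U \<inter> A) \<union> ((UNIV - U) \<inter> A)" by blast
    hence "outer A \<le> outer (U \<inter> A) + outer ((UNIV - U) \<inter> A)" using outer_Un by metis
    moreover have "A \<inter> U = U \<inter> A" "A - U = (UNIV - U) \<inter> A" by auto
    ultimately show ?thesis using outer_open_split[OF assms False, of A] by simp
  qed
  thus ?thesis by (simp add: lambda_system_def)
qed

text \<open>Compactness turns a countable cover of the whole space into a finite one.\<close>

lemma outer_UNIV: "outer UNIV = 1"
proof (rule antisym[OF outer_le_1])
  show "1 \<le> outer UNIV" unfolding outer_def
  proof (rule INF_greatest)
    fix F assume F: "F \<in> covers UNIV"
    have Fc: "continuous_on UNIV (F i)" and F0: "0 \<le> F i x" for i x using F(1) by (auto simp: covers_def)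
    show "1 \<le> (\<Sum>i. ennreal (\<Lambda> (F i)))"
    proof (rule ennreal_le_epsilon)
      fix e :: real assume e: "0 < e"
      define V where "V = (\<lambda>n. {x. 1 - e < (\<Sum>i<n. F i x)})"
      have "open (V n)" for n unfolding V_def
        by (intro open_Collect_less continuous_intros Fc)
      moreover have "UNIV \<subseteq> (\<Union>n. V n)"
      proof
        fix x :: 'a
        have "ennreal (1 - e) < 1"
          using e by (metis diff_less_eq ennreal_1 ennreal_lessI less_add_same_cancel1 zero_less_one)
        also have "1 \<le> (\<Sum>i. ennreal (F i x))" using F by (auto simp: covers_def)
        finally have "ennreal (1 - e) < (SUP n. \<Sum>i<n. ennreal (F i x))" by (simp add: suminf_eq_SUP)
        then obtain n where "ennreal (1 - e) < (\<Sum>i<n. ennreal (F i x))" by (auto simp: less_SUP_iff)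
        hence "ennreal (1 - e) < ennreal (\<Sum>i<n. F i x)" by (simp add: sum_ennreal F0)
        hence "1 - e < (\<Sum>i<n. F i x)" by (meson ennreal_leI leD not_le_imp_less)
        thus "x \<in> (\<Union>n. V n)" by (auto simp: V_def)
      qed
      ultimately obtain D where D: "finite D" "UNIV \<subseteq> (\<Union>n\<in>D. V n)"
        using compactE_image[OF compact_space, of UNIV V] by auto
      define N where "N = Max D"
      have ge: "1 - e \<le> (\<Sum>i<N. F i x)" for x
      proof -
        obtain n where "n \<in> D" "x \<in> V n" using D by auto
        hence "1 - e < (\<Sum>i<n. F i x)" "n \<le> N" using D by (auto simp: V_def N_def)
        moreover have "(\<Sum>i<n. F i x) \<le> (\<Sum>i<N. F i x)"
          using \<open>n \<le> N\<close> F0 by (intro sum_mono2) auto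
        ultimately show ?thesis by linarith
      qed
      have "1 - e \<le> \<Lambda> (\<lambda>x. \<Sum>i<N. F i x)"
        using mono[of "\<lambda>_. 1 - e" "\<lambda>x. \<Sum>i<N. F i x"] ge Fc by (auto simp: const intro!: continuous_intros)
      also have "\<dots> = (\<Sum>i<N. \<Lambda> (F i))" by (simp add: sum Fc)
      finally have "ennreal 1 \<le> ennreal ((\<Sum>i<N. \<Lambda> (F i)) + e)" by (intro ennreal_leI) simp
      also have "\<dots> = (\<Sum>i<N. ennreal (\<Lambda> (F i))) + ennreal e"
        using e by (simp add: sum_ennreal nonneg Fc F0 sum_nonneg)
      also have "\<dots> \<le> (\<Sum>i. ennreal (\<Lambda> (F i))) + ennreal e"
        by (intro add_mono sum_le_suminf) auto
      finally show "1 \<le> (\<Sum>i. ennreal (\<Lambda> (F i))) + ennreal e" by simp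
    qed
  qed
qed

section \<open>The Borel measure and its integral\<close>

definition representing_measure :: "'a measure" where
  "representing_measure = measure_of UNIV (sets borel) outer"

lemma sets_representing_measure [measurable_cong]: "sets representing_measure = sets borel"
  unfolding representing_measure_def using sets.sets_measure_of_eq[of borel]
  by (simp add: sets.sigma_sets_eq[of borel, simplified])

text \<open>Caratheodory's theorem makes \<open>outer\<close> a measure on the sigma-algebra of its
  measurable sets; that one contains the open sets, hence the Borel sets, to which the measure is
  restricted.\<close>

lemma emeasure_representing_measure:
  assumes "A \<in> sets borel" shows "emeasure representing_measure A = outer A"
proof -
  interpret sa: sigma_algebra "UNIV::'a set" "UNIV :: 'a set set"
    using sigma_algebra_Pow[of "UNIV::'a set"] by simp
  have ms: "measure_space UNIV (lambda_system UNIV UNIV outer) outer"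
    by (rule sa.caratheodory_lemma[OF outer_measure_space_outer])
  hence "sigma_algebra UNIV (lambda_system UNIV UNIV outer)" by (simp add: measure_space_def)
  hence "sigma_sets UNIV {S. open S} \<subseteq> lambda_system UNIV UNIV outer"
    using open_in_lambda_system by (intro sigma_algebra.sigma_sets_subset) auto
  hence "sets borel \<subseteq> lambda_system UNIV UNIV outer"
    unfolding borel_def by simp
  hence "measure_space UNIV (sets borel) outer"
    using measure_down[OF ms] sets.sigma_algebra_axioms[of "borel :: 'a measure"] by simp
  thus ?thesis
    unfolding representing_measure_def using assms
    by (intro emeasure_measure_of_sigma) (auto simp: measure_space_def)
qed

lemma prob_space_representing_measure: "prob_space representing_measure"
proof
  have "space representing_measure = UNIV"
    using sets_eq_imp_space_eq[OF sets_representing_measure] by simp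
  thus "emeasure representing_measure (space representing_measure) = 1"
    by (simp add: emeasure_representing_measure outer_UNIV)
qed

lemma integrable_bounded_continuous:
  assumes "continuous_on UNIV f" "\<And>x. \<bar>f x\<bar> \<le> B"
  shows "integrable representing_measure (f :: 'a \<Rightarrow> real)"
proof -
  interpret prob_space representing_measure by (rule prob_space_representing_measure)
  have "f \<in> borel_measurable representing_measure"
    using borel_measurable_continuous_onI[OF assms(1)] by simp
  thus ?thesis using assms by (intro integrable_const_bound[where B=B]) auto
qed

text \<open>Slice \<open>f\<close> into \<open>N\<close> layers of height \<open>1/N\<close>; the measure of each superlevel set is bounded by
  the value of the functional at the layer below it.\<close>

lemma integral_le_functional:
  assumes f: "continuous_on UNIV f" "\<And>x. 0 \<le> f x" "\<And>x. f x \<le> 1"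
  shows "(\<integral>x. f x \<partial>representing_measure) \<le> \<Lambda> f"
proof -
  interpret prob_space representing_measure by (rule prob_space_representing_measure)
  have sp: "space representing_measure = UNIV"
    using sets_eq_imp_space_eq[OF sets_representing_measure] by simp
  have fm [measurable]: "f \<in> borel_measurable borel"
    using borel_measurable_continuous_onI[OF assms(1)] by simp
  have bound: "(\<integral>x. f x \<partial>representing_measure) \<le> 1 / real (Suc N) + \<Lambda> f" for N
  proof -
    define K where "K = Suc N"
    have K: "K > 0" by (simp add: K_def)
    define g where "g = (\<lambda>k x. max 0 (min 1 (real K * f x - real k)))"
    define A where "A = (\<lambda>k. {x. 1 \<le> real K * f x - real k})"
    have Am [measurable]: "A k \<in> sets borel" for k unfolding A_def by measurable
    have gc: "continuous_on UNIV (g k)" for k unfolding g_def by (intro continuous_intros f)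
    have layers: "(\<Sum>k<n. max 0 (min 1 (t - real k))) = max 0 (min t (real n))" for t :: real and n
      by (induction n) auto
    have sumg: "(\<Sum>k<K. g k x) = real K * f x" for x
      unfolding g_def layers using f(2,3)[of x] K by (auto simp: mult_le_cancel_left1)
    \<comment> \<open>The shift by one links functions and sets: where \<open>g (Suc k)\<close> is
      positive, \<open>K * f\<close> exceeds k + 1, which puts the point in \<open>A k\<close>, and
      on \<open>A k\<close> the function \<open>g k\<close> is at least 1. The bottom layer
      \<open>g 0\<close> has no set to match and is bounded by 1; it causes the error 1/K.\<close>
    have gA: "g (Suc k) x \<le> indicator (A k) x" for k x
      unfolding g_def A_def by (auto simp: indicator_def)
    have Ag: "measure representing_measure (A k) \<le> \<Lambda> (g k)" for k
    proof -
      have "emeasure representing_measure (A k) = outer (A k)" by (simp add: emeasure_representing_measure)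
      also have "\<dots> \<le> ennreal (\<Lambda> (g k))"
        by (intro outer_le_fun gc) (auto simp: g_def A_def)
      finally have "ennreal (prob (A k)) \<le> ennreal (\<Lambda> (g k))" by (simp add: emeasure_eq_measure)
      moreover have "0 \<le> \<Lambda> (g k)" by (intro nonneg gc) (simp add: g_def)
      ultimately show ?thesis by (simp add: ennreal_le_iff)
    qed
    have "real K * f x \<le> 1 + (\<Sum>k<K. indicator (A k) x)" for x
    proof -
      have "real K * f x = (\<Sum>k<Suc N. g k x)" using sumg[of x] by (simp only: K_def)
      also have "\<dots> = g 0 x + (\<Sum>k<N. g (Suc k) x)" by (rule sum.lessThan_Suc_shift)
      also have "\<dots> \<le> 1 + (\<Sum>k<N. indicator (A k) x)"
        by (intro add_mono sum_mono gA) (auto simp: g_def)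
      also have "\<dots> \<le> 1 + (\<Sum>k<K. indicator (A k) x)" unfolding K_def by simp
      finally show ?thesis .
    qed
    hence "(\<integral>x. real K * f x \<partial>representing_measure) \<le> (\<integral>x. 1 + (\<Sum>k<K. indicator (A k) x) \<partial>representing_measure)"
      using f by (intro integral_mono integrable_mult_right integrable_bounded_continuous[where B=1] Bochner_Integration.integrable_add
        Bochner_Integration.integrable_sum integrable_real_indicator) (auto simp: less_top[symmetric] sets_representing_measure)
    also have "\<dots> = 1 + (\<Sum>k<K. measure representing_measure (A k))"
      by (subst Bochner_Integration.integral_add)
         (auto simp: sp Bochner_Integration.integral_sum less_top[symmetric] sets_representing_measure
           intro!: Bochner_Integration.integrable_sum integrable_real_indicator prob_space[unfolded sp])
    also have "\<dots> \<le> 1 + (\<Sum>k<K. \<Lambda> (g k))" by (intro add_mono sum_mono Ag) auto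
    also have "(\<Sum>k<K. \<Lambda> (g k)) = \<Lambda> (\<lambda>x. \<Sum>k<K. g k x)" by (simp add: sum gc)
    also have "\<dots> = real K * \<Lambda> f" unfolding sumg by (rule scale[OF f(1)])
    finally have "real K * (\<integral>x. f x \<partial>representing_measure) \<le> 1 + real K * \<Lambda> f" by simp
    thus ?thesis using K by (simp add: field_simps K_def)
  qed
  have "(\<lambda>N. 1 / real (Suc N) + \<Lambda> f) \<longlonglongrightarrow> 0 + \<Lambda> f"
    by (intro tendsto_intros LIMSEQ_Suc lim_1_over_n)
  thus ?thesis using bound by (intro LIMSEQ_le_const) auto
qed

text \<open>The one-sided bound is applied to both \<open>f\<close> and its negative. The choice c =
  1/(2B) places 1/2 + c f and 1/2 - c f in [0,1], and the constant 1/2 cancels because both the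
  measure and the functional are normalised.\<close>

lemma integral_representing_measure:
  assumes f: "continuous_on UNIV f"
  shows "(\<integral>x. f x \<partial>representing_measure) = \<Lambda> f"
proof -
  interpret prob_space representing_measure by (rule prob_space_representing_measure)
  have sp: "space representing_measure = UNIV"
    using sets_eq_imp_space_eq[OF sets_representing_measure] by simp
  have "compact (range f)" using compact_continuous_image[OF f compact_space] .
  then obtain B where B: "\<And>x. \<bar>f x\<bar> \<le> B" "B > 0"
    using compact_imp_bounded bounded_pos by (metis rangeI real_norm_def)
  have int: "integrable representing_measure f" using integrable_bounded_continuous[OF f B(1)] .
  define c where "c = 1 / (2 * B)"
  have c: "c > 0" using B by (simp add: c_def)
  have bd: "-B \<le> f x" "f x \<le> B" for x using B(1)[of x] by linarith+
  define u where "u = (\<lambda>x. 1/2 + c * f x)"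
  define v where "v = (\<lambda>x. 1/2 - c * f x)"
  have cf: "c * f x \<le> 1/2" "- (1/2) \<le> c * f x" for x
    using bd[of x] B(2) by (auto simp: c_def field_simps)
  have u01: "0 \<le> u x" "u x \<le> 1" and v01: "0 \<le> v x" "v x \<le> 1" for x
    using cf[of x] unfolding u_def v_def by linarith+
  have total: "prob UNIV = 1" using prob_space sp by simp
  have cu: "continuous_on UNIV u" and cv: "continuous_on UNIV v"
    unfolding u_def v_def by (intro continuous_intros f)+
  have ccf: "continuous_on UNIV (\<lambda>x. c * f x)" by (intro continuous_intros f)
  have cconst: "continuous_on UNIV (\<lambda>_::'a. 1/2 :: real)" by (intro continuous_intros)
  have "(\<integral>x. u x \<partial>representing_measure) \<le> \<Lambda> u" by (rule integral_le_functional[OF cu u01])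
  hence 1: "c * (\<integral>x. f x \<partial>representing_measure) \<le> c * \<Lambda> f"
    unfolding u_def add[OF cconst ccf] const scale[OF f] using int by (simp add: sp total)
  have "(\<integral>x. v x \<partial>representing_measure) \<le> \<Lambda> v" by (rule integral_le_functional[OF cv v01])
  hence 2: "c * \<Lambda> f \<le> c * (\<integral>x. f x \<partial>representing_measure)"
    unfolding v_def diff[OF cconst ccf] const scale[OF f] using int by (simp add: sp total)
  show ?thesis using 1 2 c by simp
qed

end

text \<open>Open sets form an intersection-stable generator of the Borel sets, and the measure of an
  open set is the limit of the integrals of the cutoffs by dominated convergence.\<close>

lemma borel_prob_eqI:
  fixes M N :: "'a::metric_space measure"
  assumes "prob_space M" "prob_space N" and sets: "sets M = sets borel" "sets N = sets borel"
    and eq: "\<And>f :: 'a \<Rightarrow> real. continuous_on UNIV f \<Longrightarrow> (\<And>x. \<bar>f x\<bar> \<le> 1) \<Longrightarrow> (\<integral>x. f x \<partial>M) = (\<integral>x. f x \<partial>N)"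
  shows "M = N"
proof -
  interpret M: prob_space M by fact
  interpret N: prob_space N by fact
  have sp: "space M = UNIV" "space N = UNIV"
    using sets[THEN sets_eq_imp_space_eq] by simp_all
  have open_eq: "emeasure M U = emeasure N U" if U: "open U" for U
  proof (cases "U = UNIV")
    case True thus ?thesis using M.emeasure_space_1 N.emeasure_space_1 sp by simp
  next
    case False
    define e where "e = (\<lambda>(n::nat) x. min 1 (real n * infdist x (-U)))"
    have ec: "continuous_on UNIV (e n)" for n
      unfolding e_def by (intro continuous_intros)
    have e01: "\<bar>e n x\<bar> \<le> 1" for n x unfolding e_def by (auto simp: infdist_nonneg)
    have [measurable]: "e n \<in> borel_measurable borel" for n
      using borel_measurable_continuous_onI[OF ec] .
    have elim: "(\<lambda>n. e n x) \<longlonglongrightarrow> indicator U x" for x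
      unfolding e_def by (rule infdist_cutoff_tendsto[OF U False])
    have lim: "(\<lambda>n. \<integral>x. e n x \<partial>K) \<longlonglongrightarrow> measure K U" if "prob_space K" "sets K = sets borel" for K
    proof -
      interpret K: prob_space K by fact
      have s: "space K = UNIV" using sets_eq_imp_space_eq[OF that(2)] by simp
      have "(\<lambda>n. \<integral>x. e n x \<partial>K) \<longlonglongrightarrow> (\<integral>x. indicator U x \<partial>K)"
        using U e01 elim by (intro integral_dominated_convergence[where w="\<lambda>_. 1"])
          (auto simp: that(2) cong: measurable_cong_sets)
      thus ?thesis by (simp add: s)
    qed
    have "(\<lambda>n. \<integral>x. e n x \<partial>N) \<longlonglongrightarrow> measure M U"
      using lim[OF assms(1,3)] eq[OF ec e01] by simp
    hence "measure M U = measure N U" using lim[OF assms(2,4)] LIMSEQ_unique by blast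
    thus ?thesis by (simp add: M.emeasure_eq_measure N.emeasure_eq_measure)
  qed
  have gen: "sets (borel :: 'a measure) = sigma_sets UNIV {S. open S}" unfolding borel_def by simp
  show ?thesis
  proof (rule measure_eqI_generator_eq[where E="{S. open S}" and \<Omega>=UNIV and A="\<lambda>_. UNIV"])
    show "Int_stable {S::'a set. open S}" by (auto simp: Int_stable_def intro: open_Int)
    show "sets M = sigma_sets UNIV {S. open S}" "sets N = sigma_sets UNIV {S. open S}"
      by (simp_all only: sets gen)
  qed (auto simp: open_eq)
qed

section \<open>The Ruelle-Perron-Frobenius theorem\<close>

definition birkhoff_sum :: "('a \<Rightarrow> 'a) \<Rightarrow> ('a \<Rightarrow> real) \<Rightarrow> nat \<Rightarrow> 'a \<Rightarrow> real" where
  "birkhoff_sum T b n x = (\<Sum>k<n. b ((T ^^ k) x))"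

definition fibre :: "('a \<Rightarrow> 'a) \<Rightarrow> nat \<Rightarrow> 'a \<Rightarrow> 'a set" where
  "fibre T n x = {u. (T ^^ n) u = x}"

lemma fibre_0 [simp]: "fibre T 0 x = {x}"
  by (auto simp: fibre_def)

lemma fibre_Suc: "fibre T (Suc n) x = (\<Union>y\<in>{y. T y = x}. fibre T n y)"
  by (auto simp: fibre_def)

text \<open>All that the spectral theory uses of the dynamics. In \<open>matching\<close>, \<delta>
  does not depend on \<open>n\<close>: this is bounded distortion for all iterates at once. In
  \<open>dense_orbits\<close>, a single \<open>N\<close> serves all fibres, and
  \<open>N \<ge> 1\<close> yields surjectivity of \<open>T\<close>. No modulus of continuity
  appears, so both cases of the theorem and all multiples of the potential fit.\<close>

locale ruelle_operator =
  fixes T :: "'a::metric_space \<Rightarrow> 'a" and b :: "'a \<Rightarrow> real"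
  assumes compact_space: "compact (UNIV :: 'a set)"
    and finite_preimages: "finite {y. T y = x}"
    and continuous_potential: "continuous_on UNIV b"
    and matching: "0 < \<epsilon> \<Longrightarrow> \<exists>\<delta>>0. \<forall>n x y. dist x y < \<delta> \<longrightarrow>
      (\<exists>g. bij_betw g (fibre T n x) (fibre T n y) \<and>
        (\<forall>u\<in>fibre T n x. dist u (g u) < \<epsilon> \<and> \<bar>birkhoff_sum T b n u - birkhoff_sum T b n (g u)\<bar> < \<epsilon>))"
    and dense_orbits: "0 < \<epsilon> \<Longrightarrow> \<exists>N\<ge>1. \<forall>x y. \<exists>w\<in>fibre T N x. dist w y < \<epsilon>"
begin

section \<open>Iterates of the transfer operator and their averages\<close>

abbreviation S :: "nat \<Rightarrow> 'a \<Rightarrow> real" where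
  "S \<equiv> birkhoff_sum T b"

abbreviation Lp :: "nat \<Rightarrow> ('a \<Rightarrow> real) \<Rightarrow> 'a \<Rightarrow> real" where
  "Lp n \<equiv> transfer_op T b ^^ n"

abbreviation u :: "nat \<Rightarrow> 'a \<Rightarrow> real" where
  "u n \<equiv> Lp n (\<lambda>_. 1)"

text \<open>A weighted mean of \<open>f\<close> over \<open>fibre T n x\<close>, with weights
  proportional to exp of the Birkhoff sum. Dividing by \<open>u n\<close> normalises the iterate
  before any eigenvalue is known; constants are fixed and order is preserved.\<close>

definition R :: "nat \<Rightarrow> ('a \<Rightarrow> real) \<Rightarrow> 'a \<Rightarrow> real" where
  "R n f x = Lp n f x / u n x"

lemma finite_fibre: "finite (fibre T n x)"
proof (induction n arbitrary: x)
  case (Suc n) thus ?case using finite_preimages by (simp add: fibre_Suc)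
qed simp

lemma Lp_eq: "Lp n f x = (\<Sum>w\<in>fibre T n x. exp (S n w) * f w)"
proof (induction n arbitrary: x)
  case 0 thus ?case by (simp add: birkhoff_sum_def)
next
  case (Suc n)
  have "Lp (Suc n) f x = (\<Sum>y\<in>{y. T y = x}. exp (b y) * (\<Sum>w\<in>fibre T n y. exp (S n w) * f w))"
    by (simp add: transfer_op_def Suc.IH)
  also have "\<dots> = (\<Sum>y\<in>{y. T y = x}. \<Sum>w\<in>fibre T n y. exp (S (Suc n) w) * f w)"
    unfolding sum_distrib_left
    by (intro sum.cong refl) (auto simp: birkhoff_sum_def exp_add fibre_def)
  also have "\<dots> = (\<Sum>w\<in>fibre T (Suc n) x. exp (S (Suc n) w) * f w)"
    unfolding fibre_Suc
    by (subst sum.UNION_disjoint, simp_all add: finite_fibre finite_preimages, auto simp: fibre_def)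
  finally show ?case .
qed

lemma Lp_add: "Lp n (\<lambda>x. f x + g x) x = Lp n f x + Lp n g x"
  by (simp add: Lp_eq algebra_simps sum.distrib)

lemma Lp_scale: "Lp n (\<lambda>x. c * f x) x = c * Lp n f x"
  by (simp add: Lp_eq sum_distrib_left algebra_simps)

lemma Lp_diff: "Lp n (\<lambda>x. f x - g x) x = Lp n f x - Lp n g x"
  by (simp add: Lp_eq algebra_simps sum_subtractf)

lemma Lp_comp: "Lp (n + m) f = Lp n (Lp m f)"
  by (simp add: funpow_add)

lemma Lp_mono: "(\<And>x. f x \<le> g x) \<Longrightarrow> Lp n f x \<le> Lp n g x"
  unfolding Lp_eq by (intro sum_mono mult_left_mono) auto

lemma Lp_abs_le:
  assumes "\<And>x. \<bar>f x\<bar> \<le> g x" shows "\<bar>Lp n f x\<bar> \<le> Lp n g x"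
proof -
  have "\<bar>Lp n f x\<bar> \<le> (\<Sum>w\<in>fibre T n x. \<bar>exp (S n w) * f w\<bar>)" unfolding Lp_eq by (rule sum_abs)
  also have "\<dots> \<le> Lp n g x" unfolding Lp_eq
    by (intro sum_mono) (auto simp: abs_mult assms)
  finally show ?thesis .
qed

lemma fibre_nonempty: "fibre T n x \<noteq> {}"
proof -
  have surj: "\<exists>y. T y = x" for x
  proof -
    obtain N w where "N \<ge> 1" "w \<in> fibre T N x" using dense_orbits[of 1] by force
    thus ?thesis by (cases N) (auto simp: fibre_def)
  qed
  show ?thesis
  proof (induction n arbitrary: x)
    case (Suc n) thus ?case using surj[of x] by (auto simp: fibre_Suc)
  qed simp
qed

lemma Lp_pos: "(\<And>x. 0 < f x) \<Longrightarrow> 0 < Lp n f x"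
  unfolding Lp_eq by (intro sum_pos finite_fibre fibre_nonempty) auto

lemma u_pos [simp]: "0 < u n x"
  by (rule Lp_pos) simp

lemma u_nonneg [simp]: "0 \<le> u n x"
  using u_pos[of n x] by linarith

lemma u_neq_0 [simp]: "u n x \<noteq> 0"
  using u_pos[of n x] by linarith

lemma Lp_R: "Lp n f x = R n f x * u n x"
  by (simp add: R_def)

lemma R_add: "R n (\<lambda>x. f x + g x) x = R n f x + R n g x"
  by (simp add: R_def Lp_add add_divide_distrib)

lemma R_scale: "R n (\<lambda>x. c * f x) x = c * R n f x"
  by (simp add: R_def Lp_scale)

lemma R_const: "R n (\<lambda>_. c) x = c"
  using R_scale[of n c "\<lambda>_. 1" x] by (simp add: R_def)

lemma R_mono: "(\<And>x. f x \<le> g x) \<Longrightarrow> R n f x \<le> R n g x"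
  unfolding R_def by (intro divide_right_mono Lp_mono) auto

lemma R_abs_le:
  assumes "\<And>x. \<bar>f x\<bar> \<le> B" shows "\<bar>R n f x\<bar> \<le> B"
proof -
  have "- B \<le> f x \<and> f x \<le> B" for x using assms[of x] by linarith
  hence "R n (\<lambda>_. - B) x \<le> R n f x" "R n f x \<le> R n (\<lambda>_. B) x" by (auto intro!: R_mono)
  thus ?thesis by (simp add: R_const abs_le_iff)
qed

text \<open>The later average is itself a weighted mean of the values of \<open>R n f\<close>,
  because the iterate of order n + m is the m-th iterate of \<open>R n f\<close> times
  \<open>u n\<close>. Closeness to a constant is therefore never lost.\<close>

lemma R_average:
  assumes "\<And>x. \<bar>R n f x - c\<bar> \<le> e" shows "\<bar>R (n + m) f x - c\<bar> \<le> e"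
proof -
  have "\<bar>Lp m (\<lambda>x. Lp n f x - c * u n x) x\<bar> \<le> Lp m (\<lambda>x. e * u n x) x"
  proof (rule Lp_abs_le)
    fix x
    have "\<bar>Lp n f x - c * u n x\<bar> = \<bar>R n f x - c\<bar> * u n x"
      using u_pos[of n x] by (simp add: Lp_R[of n f] abs_mult left_diff_distrib[symmetric] del: u_pos)
    also have "\<dots> \<le> e * u n x" by (intro mult_right_mono assms) simp
    finally show "\<bar>Lp n f x - c * u n x\<bar> \<le> e * u n x" .
  qed
  hence "\<bar>Lp (m + n) f x - c * u (m + n) x\<bar> \<le> e * u (m + n) x"
    unfolding Lp_diff Lp_scale Lp_comp .
  moreover have "Lp (m + n) f x - c * u (m + n) x = (R (m + n) f x - c) * u (m + n) x"
    by (simp add: Lp_R[of "m + n" f] left_diff_distrib)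
  ultimately have "\<bar>R (m + n) f x - c\<bar> * u (m + n) x \<le> e * u (m + n) x" by (simp add: abs_mult)
  thus ?thesis by (simp add: add.commute)
qed

section \<open>Bounded distortion and comparison of iterates\<close>

lemma distortion:
  assumes "0 < \<epsilon>"
  shows "\<exists>\<delta>>0. \<forall>n x y f e. dist x y < \<delta> \<longrightarrow> (\<forall>x. 0 \<le> f x) \<longrightarrow>
    (\<forall>x y. dist x y < \<epsilon> \<longrightarrow> f x \<le> f y + e) \<longrightarrow> Lp n f x \<le> exp \<epsilon> * (Lp n f y + e * u n y)"
proof -
  obtain \<delta> where \<delta>: "\<delta> > 0" and m: "\<And>n x y. dist x y < \<delta> \<Longrightarrow>
      (\<exists>g. bij_betw g (fibre T n x) (fibre T n y) \<and>
        (\<forall>u\<in>fibre T n x. dist u (g u) < \<epsilon> \<and> \<bar>S n u - S n (g u)\<bar> < \<epsilon>))"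
    using matching[OF assms] by blast
  have "Lp n f x \<le> exp \<epsilon> * (Lp n f y + e * u n y)"
    if d: "dist x y < \<delta>" and f0: "\<And>x. 0 \<le> f x" and fe: "\<And>x y. dist x y < \<epsilon> \<Longrightarrow> f x \<le> f y + e" for n x y f e
  proof -
    obtain g where g: "bij_betw g (fibre T n x) (fibre T n y)"
      "\<And>u. u\<in>fibre T n x \<Longrightarrow> dist u (g u) < \<epsilon>" "\<And>u. u\<in>fibre T n x \<Longrightarrow> \<bar>S n u - S n (g u)\<bar> < \<epsilon>"
      using m[OF d] by blast
    \<comment> \<open>The matching transports the sum to the other fibre: weights change by a factor
      of at most exp \<epsilon>, values of \<open>f\<close> by at most \<open>e\<close>.
      Nonnegativity of \<open>f\<close> allows the two estimates to be multiplied.\<close>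
    have "Lp n f x \<le> (\<Sum>w\<in>fibre T n x. exp (\<epsilon> + S n (g w)) * (f (g w) + e))"
      unfolding Lp_eq
    proof (rule sum_mono)
      fix w assume w: "w \<in> fibre T n x"
      have "S n w \<le> \<epsilon> + S n (g w)" using g(3)[OF w] by linarith
      thus "exp (S n w) * f w \<le> exp (\<epsilon> + S n (g w)) * (f (g w) + e)"
        using fe[OF g(2)[OF w]] f0[of w] by (intro mult_mono) auto
    qed
    also have "\<dots> = (\<Sum>w\<in>fibre T n y. exp (\<epsilon> + S n w) * (f w + e))"
      by (rule sum.reindex_bij_betw[OF g(1)])
    also have "\<dots> = exp \<epsilon> * (Lp n f y + e * u n y)"
      by (simp add: Lp_eq exp_add sum_distrib_left algebra_simps sum.distrib)
    finally show ?thesis .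
  qed
  with \<delta> show ?thesis by blast
qed

lemma u_distortion:
  assumes "0 < \<epsilon>"
  shows "\<exists>\<delta>>0. \<forall>n x y. dist x y < \<delta> \<longrightarrow> u n x \<le> exp \<epsilon> * u n y"
proof -
  obtain \<delta> where \<delta>: "\<delta> > 0" "\<forall>n x y f e. dist x y < \<delta> \<longrightarrow> (\<forall>x. 0 \<le> f x) \<longrightarrow>
    (\<forall>x y. dist x y < \<epsilon> \<longrightarrow> f x \<le> f y + e) \<longrightarrow> Lp n f x \<le> exp \<epsilon> * (Lp n f y + e * u n y)"
    using distortion[OF assms] by blast
  have "u n x \<le> exp \<epsilon> * u n y" if "dist x y < \<delta>" for n x y
    using \<delta>(2)[rule_format, of x y "\<lambda>_. 1" 0 n] that by simp
  thus ?thesis using \<delta>(1) by blast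
qed

lemma continuous_u: "continuous_on UNIV (u n)"
proof -
  have "continuous_on UNIV (\<lambda>x. ln (u n x))"
    unfolding continuous_on_iff
  proof (intro ballI allI impI)
    fix x :: 'a and e :: real assume e: "0 < e"
    obtain \<delta> where \<delta>: "\<delta> > 0" "\<And>n x y. dist x y < \<delta> \<Longrightarrow> u n x \<le> exp (e/2) * u n y"
      using u_distortion[of "e/2"] e by auto
    have le: "ln (u n x) \<le> e/2 + ln (u n y)" if "dist x y < \<delta>" for x y
    proof -
      have "ln (u n x) \<le> ln (exp (e/2) * u n y)" using \<delta>(2)[OF that] by (subst ln_le_cancel_iff) auto
      thus ?thesis by (simp add: ln_mult)
    qed
    have "dist (ln (u n y)) (ln (u n x)) < e" if "dist y x < \<delta>" for y
      using le[of x y] le[of y x] that e unfolding dist_real_def by (simp add: dist_commute)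
    thus "\<exists>d>0. \<forall>x'\<in>UNIV. dist x' x < d \<longrightarrow> dist (ln (u n x')) (ln (u n x)) < e"
      using \<delta>(1) by blast
  qed
  hence "continuous_on UNIV (\<lambda>x. exp (ln (u n x)))" by (rule continuous_on_exp)
  thus ?thesis by simp
qed

lemma bounded_continuous:
  assumes "continuous_on UNIV (f :: 'a \<Rightarrow> real)"
  shows "\<exists>B>0. \<forall>x. \<bar>f x\<bar> \<le> B"
proof -
  have "bounded (range f)" using compact_continuous_image[OF assms compact_space] compact_imp_bounded by blast
  thus ?thesis by (auto simp: bounded_pos)
qed

lemma S_bound: "\<exists>B>0. \<forall>n x. \<bar>S n x\<bar> \<le> real n * B"
proof -
  obtain B where B: "B > 0" "\<And>x. \<bar>b x\<bar> \<le> B" using bounded_continuous[OF continuous_potential] by blast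
  have "\<bar>S n x\<bar> \<le> real n * B" for n x
  proof -
    have "\<bar>S n x\<bar> \<le> (\<Sum>k<n. \<bar>b ((T ^^ k) x)\<bar>)" unfolding birkhoff_sum_def by (rule sum_abs)
    also have "\<dots> \<le> (\<Sum>k<n. B)" by (intro sum_mono B)
    finally show ?thesis by simp
  qed
  thus ?thesis using B(1) by blast
qed

lemma Lp_ge_branch:
  assumes "w \<in> fibre T n x" "\<And>x. 0 \<le> f x"
  shows "exp (S n w) * f w \<le> Lp n f x"
  unfolding Lp_eq using assms by (intro member_le_sum finite_fibre) auto

text \<open>A Harnack inequality. Some \<open>w\<close> over \<open>y\<close> at depth
  \<open>N\<close> lies close to \<open>x\<close>, so \<open>u n x\<close> is comparable with
  \<open>u n w\<close>, a single branch of the N-th iterate of \<open>u n\<close> at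
  \<open>y\<close>. Exchanging the two iterations turns this into the n-th iterate of
  \<open>u N\<close>, and \<open>u N\<close> is bounded by a constant independent of
  \<open>n\<close>.\<close>

lemma u_ratio_bounded: "\<exists>M\<ge>1. \<forall>n x y. u n x \<le> M * u n y"
proof -
  obtain B where B: "B > 0" "\<And>n x. \<bar>S n x\<bar> \<le> real n * B" using S_bound by blast
  obtain \<delta> where \<delta>: "\<delta> > 0" "\<And>n x y. dist x y < \<delta> \<Longrightarrow> u n x \<le> exp 1 * u n y"
    using u_distortion[of 1] by auto
  obtain N where N: "\<And>x y. \<exists>w\<in>fibre T N x. dist w y < \<delta>" using dense_orbits[OF \<delta>(1)] by blast
  obtain C where C: "C > 0" "\<And>x. \<bar>u N x\<bar> \<le> C" using bounded_continuous[OF continuous_u] by blast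
  define M where "M = exp (1 + real N * B) * C"
  have le: "u n x \<le> M * u n y" for n x y
  proof -
    obtain w where w: "w \<in> fibre T N y" "dist w x < \<delta>" using N by blast
    have "u n x \<le> exp 1 * u n w" using \<delta>(2)[of x w n] w(2) by (simp add: dist_commute)
    also have "\<dots> \<le> exp 1 * (exp (real N * B) * (exp (S N w) * u n w))"
    proof -
      have "1 \<le> exp (real N * B + S N w)" using B(2)[of N w] by simp
      hence "1 * u n w \<le> exp (real N * B + S N w) * u n w" by (intro mult_right_mono) auto
      thus ?thesis by (simp add: exp_add mult_ac)
    qed
    also have "\<dots> \<le> exp 1 * (exp (real N * B) * (C * u n y))"
    proof -
      have "exp (S N w) * u n w \<le> Lp N (u n) y" by (rule Lp_ge_branch[OF w(1)]) simp
      also have "\<dots> = Lp n (u N) y" unfolding Lp_comp[symmetric] by (simp add: add.commute)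
      also have "\<dots> \<le> Lp n (\<lambda>_. C * 1) y" using C(2) by (intro Lp_mono) (simp add: abs_le_D1)
      also have "\<dots> = C * u n y" by (rule Lp_scale)
      finally show ?thesis by simp
    qed
    finally show ?thesis by (simp add: M_def exp_add mult_ac)
  qed
  have "1 \<le> M" using le[of 0 undefined undefined] by simp
  thus ?thesis using le by blast
qed

text \<open>When \<open>R (n + N) f\<close> is written as a mean of \<open>R n f\<close> over a
  fibre of depth \<open>N\<close>, this bounds the weight of every branch from below, uniformly in
  \<open>n\<close>.\<close>

lemma branch_weight_bounded: "\<exists>\<alpha>>0. \<forall>n x. \<forall>w\<in>fibre T N x. \<alpha> * u (n + N) x \<le> exp (S N w) * u n w"
proof -
  obtain B where B: "B > 0" "\<And>n x. \<bar>S n x\<bar> \<le> real n * B" using S_bound by blast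
  obtain M where M: "M \<ge> 1" "\<And>n x y. u n x \<le> M * u n y" using u_ratio_bounded by blast
  obtain C where C: "C > 0" "\<And>x. \<bar>u N x\<bar> \<le> C" using bounded_continuous[OF continuous_u] by blast
  define \<alpha> where "\<alpha> = exp (- (real N * B)) / (M * C)"
  have "\<alpha> * u (n + N) x \<le> exp (S N w) * u n w" if "w \<in> fibre T N x" for n x w
  proof -
    have "u (n + N) x = Lp N (u n) x" unfolding Lp_comp[symmetric] by (simp add: add.commute)
    also have "\<dots> \<le> Lp N (\<lambda>_. (M * u n w) * 1) x" using M(2) by (intro Lp_mono) simp
    also have "\<dots> = M * u n w * u N x" by (rule Lp_scale)
    also have "\<dots> \<le> M * u n w * C" using C(2)[of x] M(1) by (intro mult_left_mono) (auto simp: abs_le_D1)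
    finally have "\<alpha> * u (n + N) x \<le> \<alpha> * (M * u n w * C)"
      using M(1) C(1) by (intro mult_left_mono) (auto simp: \<alpha>_def)
    also have "\<dots> = exp (- (real N * B)) * u n w" using M(1) C(1) by (simp add: \<alpha>_def)
    also have "\<dots> \<le> exp (S N w) * u n w" using B(2)[of N w] by (intro mult_right_mono) auto
    finally show ?thesis .
  qed
  moreover have "\<alpha> > 0" using M(1) C(1) by (simp add: \<alpha>_def)
  ultimately show ?thesis by blast
qed

section \<open>Equicontinuous families and the loss of oscillation\<close>

definition equicontinuous_bounded :: "('a \<Rightarrow> real) set \<Rightarrow> real \<Rightarrow> bool" where
  "equicontinuous_bounded F B \<longleftrightarrow> (\<forall>f\<in>F. \<forall>x. \<bar>f x\<bar> \<le> B) \<and>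
     (\<forall>e>0. \<exists>\<delta>>0. \<forall>f\<in>F. \<forall>x y. dist x y < \<delta> \<longrightarrow> \<bar>f x - f y\<bar> \<le> e)"

lemma equicontinuous_bounded_singleton:
  assumes "continuous_on UNIV f"
  shows "\<exists>B. equicontinuous_bounded {f} B"
proof -
  obtain B where B: "\<forall>x. \<bar>f x\<bar> \<le> B" using bounded_continuous[OF assms] by blast
  have "\<exists>\<delta>>0. \<forall>x y. dist x y < \<delta> \<longrightarrow> \<bar>f x - f y\<bar> \<le> e" if e: "e > 0" for e
  proof -
    have "uniformly_continuous_on UNIV f"
      using compact_uniformly_continuous[OF assms compact_space] .
    then obtain d where d: "d > 0" "\<forall>x\<in>UNIV. \<forall>y\<in>UNIV. dist y x < d \<longrightarrow> dist (f y) (f x) < e"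
      unfolding uniformly_continuous_on_def using e by blast
    have "\<bar>f x - f y\<bar> \<le> e" if "dist x y < d" for x y
    proof -
      have "dist (f x) (f y) < e" using d(2) that by blast
      thus ?thesis by (simp add: dist_real_def)
    qed
    thus ?thesis using d(1) by blast
  qed
  hence "equicontinuous_bounded {f} B" using B by (simp add: equicontinuous_bounded_def)
  thus ?thesis by (rule exI)
qed

lemma R_equicontinuous:
  assumes F: "equicontinuous_bounded F B" and e: "0 < e"
  shows "\<exists>\<delta>>0. \<forall>n. \<forall>f\<in>F. \<forall>x y. dist x y < \<delta> \<longrightarrow> \<bar>R n f x - R n f y\<bar> \<le> e"
proof -
  define B' where "B' = \<bar>B\<bar>"
  have FB: "\<bar>f x\<bar> \<le> B'" if "f \<in> F" for f x
    using F that unfolding equicontinuous_bounded_def B'_def by (meson abs_ge_self order_trans)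
  \<comment> \<open>The error to be made small. Numerator and denominator of \<open>R n f\<close>
    contribute one factor exp \<epsilon> each, 2 B' bounds the shifted function, and e/4 is its
    variation at scale \<epsilon>.\<close>
  have "((\<lambda>\<epsilon>. (exp (2 * \<epsilon>) - 1) * (2 * B') + exp (2 * \<epsilon>) * (e/4)) \<longlongrightarrow> e/4) (at_right 0)"
    by (auto intro!: tendsto_eq_intros)
  moreover have "e/4 < e" using e by simp
  ultimately have "\<forall>\<^sub>F \<epsilon> in at_right 0. (exp (2 * \<epsilon>) - 1) * (2 * B') + exp (2 * \<epsilon>) * (e/4) < e"
    by (rule order_tendstoD)
  moreover obtain \<eta> where \<eta>: "\<eta> > 0" "\<And>f x y. f \<in> F \<Longrightarrow> dist x y < \<eta> \<Longrightarrow> \<bar>f x - f y\<bar> \<le> e/4"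
  proof -
    have "e/4 > 0" using e by simp
    thus ?thesis using F that unfolding equicontinuous_bounded_def by blast
  qed
  hence "\<forall>\<^sub>F \<epsilon> in at_right 0. \<epsilon> < \<eta>" "\<forall>\<^sub>F \<epsilon> in at_right 0. 0 < (\<epsilon>::real)"
    by (auto simp: eventually_at_right_less intro: eventually_at_right_real eventually_at_rightI order_tendstoD tendsto_ident_at)
  ultimately have "\<forall>\<^sub>F \<epsilon> in at_right 0. (exp (2 * \<epsilon>) - 1) * (2 * B') + exp (2 * \<epsilon>) * (e/4) < e \<and> \<epsilon> < \<eta> \<and> 0 < \<epsilon>"
    by (auto elim: eventually_elim2 intro: eventually_conj)
  then obtain \<epsilon> where \<epsilon>: "(exp (2 * \<epsilon>) - 1) * (2 * B') + exp (2 * \<epsilon>) * (e/4) < e" "\<epsilon> < \<eta>" "0 < \<epsilon>"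
    using eventually_happens[of _ "at_right (0::real)"] by (auto simp: trivial_limit_at_right_real)
  obtain \<delta>1 where \<delta>1: "\<delta>1 > 0" "\<And>n x y f e. dist x y < \<delta>1 \<Longrightarrow> (\<And>x. 0 \<le> f x) \<Longrightarrow>
    (\<And>x y. dist x y < \<epsilon> \<Longrightarrow> f x \<le> f y + e) \<Longrightarrow> Lp n f x \<le> exp \<epsilon> * (Lp n f y + e * u n y)"
    using distortion[OF \<epsilon>(3)] by blast
  obtain \<delta>2 where \<delta>2: "\<delta>2 > 0" "\<And>n x y. dist x y < \<delta>2 \<Longrightarrow> u n x \<le> exp \<epsilon> * u n y"
    using u_distortion[OF \<epsilon>(3)] by auto
  have one_sided: "R n f x - R n f y \<le> e" if f: "f \<in> F" and d: "dist x y < min \<delta>1 \<delta>2" for n f x y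
  proof -
    \<comment> \<open>The shift makes the function nonnegative, as \<open>distortion\<close>
      demands; averages move by the same constant, so their differences do not change.\<close>
    define g where "g = (\<lambda>x. f x + B')"
    have gR: "R n g x = R n f x + B'" for x unfolding g_def R_add R_const ..
    have g0: "0 \<le> g x" "g x \<le> 2 * B'" for x using FB[OF f, of x] by (auto simp: g_def)
    have ge: "g x \<le> g y + e/4" if "dist x y < \<epsilon>" for x y
      using \<eta>(2)[OF f, of x y] that \<epsilon>(2) unfolding g_def by linarith
    have gRB: "0 \<le> R n g y" "R n g y \<le> 2 * B'"
      using R_mono[of "\<lambda>_. 0" g n y] R_mono[of g "\<lambda>_. 2 * B'" n y] g0 by (auto simp: R_const)
    have "Lp n g x \<le> exp \<epsilon> * (Lp n g y + e/4 * u n y)"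
      using \<delta>1(2)[of x y g "e/4" n] g0 ge d by auto
    also have "\<dots> = exp \<epsilon> * (R n g y + e/4) * u n y" by (simp add: Lp_R[of n g] algebra_simps)
    also have "\<dots> \<le> exp \<epsilon> * (R n g y + e/4) * (exp \<epsilon> * u n x)"
    proof (rule mult_left_mono)
      show "u n y \<le> exp \<epsilon> * u n x" using \<delta>2(2)[of y x n] d by (simp add: dist_commute)
      show "0 \<le> exp \<epsilon> * (R n g y + e/4)" using gRB e by simp
    qed
    also have "\<dots> = exp (2 * \<epsilon>) * (R n g y + e/4) * u n x"
      by (simp add: exp_double power2_eq_square)
    finally have "R n g x * u n x \<le> exp (2 * \<epsilon>) * (R n g y + e/4) * u n x" by (simp add: Lp_R[of n g])
    hence "R n g x \<le> exp (2 * \<epsilon>) * (R n g y + e/4)" by simp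
    hence "R n g x - R n g y \<le> (exp (2 * \<epsilon>) - 1) * R n g y + exp (2 * \<epsilon>) * (e/4)"
      by (simp add: algebra_simps)
    also have "\<dots> \<le> (exp (2 * \<epsilon>) - 1) * (2 * B') + exp (2 * \<epsilon>) * (e/4)"
      using \<epsilon>(3) gRB by (intro add_mono mult_left_mono) auto
    finally show ?thesis using \<epsilon>(1) gR by simp
  qed
  show ?thesis
  proof (intro exI[of _ "min \<delta>1 \<delta>2"] conjI allI ballI impI)
    fix n f and x y :: 'a assume f: "f \<in> F" and d: "dist x y < min \<delta>1 \<delta>2"
    have "R n f x - R n f y \<le> e" using d by (rule one_sided[OF f])
    moreover have "R n f y - R n f x \<le> e"
      by (rule one_sided[OF f]) (use d in \<open>simp add: dist_commute\<close>)
    ultimately show "\<bar>R n f x - R n f y\<bar> \<le> e" by (simp add: abs_le_iff)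
  qed (use \<delta>1 \<delta>2 in auto)
qed

text \<open>Two averages whose weights both charge a pair of points with close values cannot differ by the
  full oscillation.\<close>

lemma average_contraction:
  fixes p q r :: "'b \<Rightarrow> real"
  assumes fin: "finite P" "finite Q" and p: "\<And>x. x \<in> P \<Longrightarrow> 0 \<le> p x" "(\<Sum>x\<in>P. p x) = 1"
    and q: "\<And>x. x \<in> Q \<Longrightarrow> 0 \<le> q x" "(\<Sum>x\<in>Q. q x) = 1"
    and D: "\<And>x y. x \<in> P \<Longrightarrow> y \<in> Q \<Longrightarrow> r x - r y \<le> D"
    and x0: "x0 \<in> P" "\<alpha> \<le> p x0" and y0: "y0 \<in> Q" "\<alpha> \<le> q y0" and "0 \<le> \<alpha>"
    and d: "r x0 - r y0 \<le> d" "d \<le> D"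
  shows "(\<Sum>x\<in>P. p x * r x) - (\<Sum>y\<in>Q. q y * r y) \<le> (1 - \<alpha>\<^sup>2) * D + \<alpha>\<^sup>2 * d"
proof -
  have "\<alpha>\<^sup>2 * (D - d) \<le> (p x0 * q y0) * (D - (r x0 - r y0))"
    unfolding power2_eq_square using assms by (intro mult_mono) auto
  also have "\<dots> \<le> (\<Sum>(x, y)\<in>P \<times> Q. (p x * q y) * (D - (r x - r y)))"
    using member_le_sum[of "(x0, y0)" "P \<times> Q" "\<lambda>(x, y). (p x * q y) * (D - (r x - r y))"] assms
    by (fastforce intro!: mult_nonneg_nonneg)
  also have "\<dots> = (\<Sum>x\<in>P. \<Sum>y\<in>Q. (p x * q y) * (D - (r x - r y)))"
    by (simp add: sum.cartesian_product)
  also have "\<dots> = (\<Sum>x\<in>P. \<Sum>y\<in>Q. p x * q y * D - p x * r x * q y + p x * (q y * r y))"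
    by (intro sum.cong refl) (simp add: algebra_simps)
  also have "\<dots> = D - (\<Sum>x\<in>P. p x * r x) + (\<Sum>y\<in>Q. q y * r y)"
    by (simp add: sum.distrib sum_subtractf sum_distrib_left[symmetric] sum_distrib_right[symmetric] p q)
  finally show ?thesis by (simp add: algebra_simps)
qed

text \<open>At \<open>x\<close> and at \<open>y\<close> the new average is a mean of
  \<open>R n f\<close> over the respective fibre, with every weight at least \<alpha>. Both fibres
  meet a small ball around one common point, here \<open>x\<close> itself, which supplies the pair
  with close values for \<open>average_contraction\<close>.\<close>

lemma R_oscillation_step:
  assumes \<epsilon>: "0 < \<epsilon>" and \<delta>: "\<And>x y. dist x y < \<delta> \<Longrightarrow> \<bar>R n f x - R n f y\<bar> \<le> \<epsilon>"
    and N: "\<And>x y. \<exists>w\<in>fibre T N x. dist w y < \<delta>/2"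
    and \<alpha>: "0 < \<alpha>" "\<And>n x w. w\<in>fibre T N x \<Longrightarrow> \<alpha> * u (n + N) x \<le> exp (S N w) * u n w"
    and D: "\<And>x y. R n f x - R n f y \<le> D" "\<epsilon> \<le> D"
  shows "R (n + N) f x - R (n + N) f y \<le> (1 - \<alpha>\<^sup>2) * D + \<alpha>\<^sup>2 * \<epsilon>"
proof -
  define p where "p = (\<lambda>x w. exp (S N w) * u n w / u (n + N) x)"
  have un: "u (n + N) x = Lp N (u n) x" for x unfolding Lp_comp[symmetric] by (simp add: add.commute)
  have psum: "(\<Sum>w\<in>fibre T N x. p x w) = 1" for x
    unfolding p_def sum_divide_distrib[symmetric] Lp_eq[symmetric, of N "u n"] un[symmetric] by simp
  have Rsum: "R (n + N) f x = (\<Sum>w\<in>fibre T N x. p x w * R n f w)" for x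
  proof -
    have "Lp (n + N) f x = Lp N (Lp n f) x" unfolding Lp_comp[symmetric] by (simp add: add.commute)
    also have "\<dots> = (\<Sum>w\<in>fibre T N x. exp (S N w) * u n w * R n f w)"
      unfolding Lp_eq[of N] by (intro sum.cong refl) (simp add: Lp_R[of n f])
    finally show ?thesis unfolding R_def[of "n + N"]
      by (simp add: p_def sum_divide_distrib divide_simps)
  qed
  have p\<alpha>: "\<alpha> \<le> p x w" if "w \<in> fibre T N x" for x w
    using \<alpha>(2)[OF that, of n] by (simp add: p_def pos_le_divide_eq)
  obtain w1 where w1: "w1 \<in> fibre T N x" "dist w1 x < \<delta>/2" using N by blast
  obtain w2 where w2: "w2 \<in> fibre T N y" "dist w2 x < \<delta>/2" using N by blast
  have "dist w1 w2 < \<delta>" using w1(2) w2(2) by (rule dist_triangle_half_l)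
  hence "R n f w1 - R n f w2 \<le> \<epsilon>" using \<delta>[of w1 w2] by linarith
  thus ?thesis unfolding Rsum
    using w1(1) w2(1) p\<alpha> psum D \<alpha>(1)
    by (intro average_contraction[where ?x0.0 = w1 and ?y0.0 = w2]) (auto simp: finite_fibre p_def)
qed

lemma R_oscillation:
  assumes F: "equicontinuous_bounded F B" and e: "0 < e"
  shows "\<exists>N0. \<forall>n\<ge>N0. \<forall>f\<in>F. \<forall>x y. \<bar>R n f x - R n f y\<bar> \<le> e"
proof -
  obtain \<delta> where \<delta>: "\<delta> > 0" "\<And>n f x y. f \<in> F \<Longrightarrow> dist x y < \<delta> \<Longrightarrow> \<bar>R n f x - R n f y\<bar> \<le> e/2"
    using R_equicontinuous[OF F, of "e/2"] e by (metis half_gt_zero)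
  obtain N where N: "\<And>x y. \<exists>w\<in>fibre T N x. dist w y < \<delta>/2" using dense_orbits[of "\<delta>/2"] \<delta>(1) by auto
  obtain \<alpha> where \<alpha>: "\<alpha> > 0" "\<And>n x w. w\<in>fibre T N x \<Longrightarrow> \<alpha> * u (n + N) x \<le> exp (S N w) * u n w"
    using branch_weight_bounded[of N] by blast
  \<comment> \<open>Capping \<alpha> at 1/2 places \<kappa> strictly between 0 and 1, so that the
    powers of 1 - \<kappa> decay.\<close>
  define \<kappa> where "\<kappa> = (min \<alpha> (1/2))\<^sup>2"
  have \<alpha>1: "min \<alpha> (1/2) > 0" using \<alpha> by simp
  have \<alpha>2: "min \<alpha> (1/2) * u (n + N) x \<le> exp (S N w) * u n w" if "w \<in> fibre T N x" for n x w
  proof -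
    have "min \<alpha> (1/2) * u (n + N) x \<le> \<alpha> * u (n + N) x" by (intro mult_right_mono) auto
    thus ?thesis using \<alpha>(2)[OF that, of n] by linarith
  qed
  have \<kappa>: "0 < \<kappa>" "\<kappa> < 1"
    using \<alpha>1 power_strict_mono[of "min \<alpha> (1/2)" 1 2] unfolding \<kappa>_def by auto
  define B' where "B' = \<bar>B\<bar>"
  have FB: "\<bar>f x\<bar> \<le> B'" if "f \<in> F" for f x
    using F that unfolding equicontinuous_bounded_def B'_def by (meson abs_ge_self order_trans)
  \<comment> \<open>The recursion D -> (1 - \<kappa>) D + \<kappa> e/2 has the fixed point e/2, and
    the distance to it shrinks by 1 - \<kappa> at each step, from a start of at most 2 B'. The free
    offset \<open>n\<close> covers indices that are no multiples of \<open>N\<close>.\<close>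
  have osc: "R (n + j * N) f x - R (n + j * N) f y \<le> e/2 + (1 - \<kappa>) ^ j * (2 * B')" if f: "f \<in> F" for n j f x y
  proof (induction j arbitrary: x y)
    case 0
    show ?case using R_abs_le[of f B' n x, OF FB[OF f]] R_abs_le[of f B' n y, OF FB[OF f]] e by auto
  next
    case (Suc j)
    have "R (n + j * N + N) f x - R (n + j * N + N) f y \<le>
       (1 - (min \<alpha> (1/2))\<^sup>2) * (e/2 + (1 - \<kappa>) ^ j * (2 * B')) + (min \<alpha> (1/2))\<^sup>2 * (e/2)"
      using Suc.IH \<delta>(2)[OF f] N \<alpha>1 \<alpha>2 e \<kappa>
      by (intro R_oscillation_step[where \<delta>=\<delta>]) (auto simp: B'_def)
    also have "\<dots> = e/2 + (1 - \<kappa>) ^ Suc j * (2 * B')"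
      unfolding \<kappa>_def[symmetric] by (simp add: field_simps)
    finally show ?case by (simp add: algebra_simps)
  qed
  have "(\<lambda>j. e/2 + (1 - \<kappa>) ^ j * (2 * B')) \<longlonglongrightarrow> e/2 + 0 * (2 * B')"
    using \<kappa> by (intro tendsto_intros LIMSEQ_realpow_zero) auto
  hence "\<forall>\<^sub>F j in sequentially. e/2 + (1 - \<kappa>) ^ j * (2 * B') < e"
    using e by (intro order_tendstoD(2)[where y="e/2"]) auto
  then obtain j where j: "e/2 + (1 - \<kappa>) ^ j * (2 * B') < e" by (auto simp: eventually_sequentially)
  have le: "R n f x - R n f y \<le> e" if "n \<ge> j * N" "f \<in> F" for n f x y
    using osc[OF that(2), of "n - j * N" j x y] j that(1) by simp
  have "\<bar>R n f x - R n f y\<bar> \<le> e" if "n \<ge> j * N" "f \<in> F" for n f x y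
    using le[OF that, of x y] le[OF that, of y x] by linarith
  thus ?thesis by blast
qed

text \<open>The limit does not depend on the base point; see \<open>R_uniform\<close>.\<close>

definition \<Lambda> :: "('a \<Rightarrow> real) \<Rightarrow> real" where
  "\<Lambda> f = lim (\<lambda>n. R n f undefined)"

text \<open>Once \<open>R n f\<close> oscillates by at most \<open>e\<close>, all later averages
  stay within \<open>e\<close> of any one of its values, by \<open>R_average\<close>. This gives the
  Cauchy property, and letting the later index tend to infinity gives a threshold that depends on
  the family only.\<close>

lemma R_uniform_limit:
  assumes F: "equicontinuous_bounded F B" and e: "0 < e"
  shows "\<exists>N0. \<forall>n\<ge>N0. \<forall>f\<in>F. \<forall>x. \<bar>R n f x - \<Lambda> f\<bar> \<le> e"
proof -
  have close: "\<bar>R (n + m) f x - R n f y\<bar> \<le> e"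
    if "\<And>x y. \<bar>R n f x - R n f y\<bar> \<le> e" for n m f x y e
    by (rule R_average) (rule that)
  have conv: "(\<lambda>n. R n f undefined) \<longlonglongrightarrow> \<Lambda> f" if f: "f \<in> F" for f
  proof -
    have "Cauchy (\<lambda>n. R n f undefined)"
    proof (rule CauchyI')
      fix e :: real assume e: "0 < e"
      obtain N0 where N0: "\<And>n x y. n \<ge> N0 \<Longrightarrow> \<bar>R n f x - R n f y\<bar> \<le> e/2"
        using R_oscillation[OF F, of "e/2"] e f by (metis half_gt_zero)
      have "dist (R m f undefined) (R n f undefined) < e" if "m \<ge> N0" "n > m" for m n
        using close[of m f "e/2" "n - m" undefined undefined] N0[OF that(1)] that e by (simp add: dist_real_def abs_minus_commute)
      thus "\<exists>M. \<forall>m\<ge>M. \<forall>n>m. dist (R m f undefined) (R n f undefined) < e" by blast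
    qed
    thus ?thesis unfolding \<Lambda>_def by (simp add: Cauchy_convergent_iff convergent_LIMSEQ_iff)
  qed
  obtain N0 where N0: "\<And>n f x y. n \<ge> N0 \<Longrightarrow> f \<in> F \<Longrightarrow> \<bar>R n f x - R n f y\<bar> \<le> e"
    using R_oscillation[OF F e] by blast
  have "\<bar>R n f x - \<Lambda> f\<bar> \<le> e" if "n \<ge> N0" "f \<in> F" for n f x
  proof -
    have "(\<lambda>m. \<bar>R (m + n) f undefined - R n f x\<bar>) \<longlonglongrightarrow> \<bar>\<Lambda> f - R n f x\<bar>"
      by (intro tendsto_intros LIMSEQ_ignore_initial_segment[OF conv[OF that(2)]])
    moreover have "\<bar>R (m + n) f undefined - R n f x\<bar> \<le> e" for m
      using close[of n f e m undefined x] N0[OF that] by (simp add: add.commute)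
    ultimately have "\<bar>\<Lambda> f - R n f x\<bar> \<le> e" by (intro LIMSEQ_le_const2) auto
    thus ?thesis by (simp add: abs_minus_commute)
  qed
  thus ?thesis by blast
qed

lemma R_uniform:
  assumes "continuous_on UNIV f" "0 < e"
  shows "\<exists>N0. \<forall>n\<ge>N0. \<forall>x. \<bar>R n f x - \<Lambda> f\<bar> \<le> e"
proof -
  obtain B where "equicontinuous_bounded {f} B" using equicontinuous_bounded_singleton[OF assms(1)] ..
  from R_uniform_limit[OF this assms(2)] show ?thesis by simp
qed

lemma R_tendsto:
  assumes "continuous_on UNIV f" shows "(\<lambda>n. R n f x) \<longlonglongrightarrow> \<Lambda> f"
proof (rule LIMSEQ_I)
  fix e :: real assume e: "0 < e"
  obtain N0 where "\<forall>n\<ge>N0. \<forall>x. \<bar>R n f x - \<Lambda> f\<bar> \<le> e/2" using R_uniform[OF assms, of "e/2"] e by auto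
  moreover have "e / 2 < e" using e by simp
  ultimately have "\<forall>n\<ge>N0. norm (R n f x - \<Lambda> f) < e" by (metis le_less_trans real_norm_def)
  thus "\<exists>no. \<forall>n\<ge>no. norm (R n f x - \<Lambda> f) < e" by blast
qed

section \<open>The limit functional and the leading eigenvalue\<close>

abbreviation L :: "('a \<Rightarrow> real) \<Rightarrow> 'a \<Rightarrow> real" where
  "L \<equiv> transfer_op T b"

lemma Lp_Suc: "Lp (Suc n) f = Lp n (L f)"
  by (simp add: funpow_swap1)

lemma continuous_R:
  assumes "continuous_on UNIV f" shows "continuous_on UNIV (R n f)"
proof -
  obtain B where F: "equicontinuous_bounded {f} B" using equicontinuous_bounded_singleton[OF assms] ..
  show ?thesis unfolding continuous_on_iff
  proof (intro ballI allI impI)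
    fix x :: 'a and e :: real assume e: "0 < e"
    hence "0 < e/2" by simp
    from R_equicontinuous[OF F this] obtain \<delta> where \<delta>: "\<delta> > 0"
      "\<And>x y. dist x y < \<delta> \<Longrightarrow> \<bar>R n f x - R n f y\<bar> \<le> e/2" by blast
    have "dist (R n f y) (R n f x) < e" if "dist y x < \<delta>" for y
      using \<delta>(2)[OF that] e by (simp add: dist_real_def)
    thus "\<exists>d>0. \<forall>x'\<in>UNIV. dist x' x < d \<longrightarrow> dist (R n f x') (R n f x) < e" using \<delta>(1) by blast
  qed
qed

text \<open>Continuity is read off the factorisation into \<open>R n f\<close> and
  \<open>u n\<close>, hence from the matching of fibres; no inverse branches have to be
  constructed.\<close>

lemma continuous_Lp:
  assumes "continuous_on UNIV f" shows "continuous_on UNIV (Lp n f)"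
proof -
  have "continuous_on UNIV (\<lambda>x. R n f x * u n x)" by (intro continuous_intros continuous_R assms continuous_u)
  thus ?thesis by (simp add: R_def)
qed

lemma continuous_L: "continuous_on UNIV f \<Longrightarrow> continuous_on UNIV (L f)"
  using continuous_Lp[of f 1] by simp

sublocale functional: positive_functional \<Lambda>
proof
  show "compact (UNIV :: 'a set)" by (rule compact_space)
next
  fix f g :: "'a \<Rightarrow> real" assume f: "continuous_on UNIV f" and g: "continuous_on UNIV g"
  have "continuous_on UNIV (\<lambda>x. f x + g x)" using f g by (intro continuous_intros)
  hence "(\<lambda>n. R n (\<lambda>x. f x + g x) undefined) \<longlonglongrightarrow> \<Lambda> (\<lambda>x. f x + g x)" by (rule R_tendsto)
  moreover have "(\<lambda>n. R n (\<lambda>x. f x + g x) undefined) \<longlonglongrightarrow> \<Lambda> f + \<Lambda> g"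
    unfolding R_add by (intro tendsto_add R_tendsto f g)
  ultimately show "\<Lambda> (\<lambda>x. f x + g x) = \<Lambda> f + \<Lambda> g" by (rule LIMSEQ_unique)
next
  fix f :: "'a \<Rightarrow> real" and c assume f: "continuous_on UNIV f"
  have "continuous_on UNIV (\<lambda>x. c * f x)" using f by (intro continuous_intros)
  hence "(\<lambda>n. R n (\<lambda>x. c * f x) undefined) \<longlonglongrightarrow> \<Lambda> (\<lambda>x. c * f x)" by (rule R_tendsto)
  moreover have "(\<lambda>n. R n (\<lambda>x. c * f x) undefined) \<longlonglongrightarrow> c * \<Lambda> f"
    unfolding R_scale by (intro tendsto_mult_left R_tendsto f)
  ultimately show "\<Lambda> (\<lambda>x. c * f x) = c * \<Lambda> f" by (rule LIMSEQ_unique)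
next
  fix f :: "'a \<Rightarrow> real" assume f: "continuous_on UNIV f" and f0: "\<And>x. 0 \<le> f x"
  have "R n f undefined \<ge> 0" for n using R_mono[of "\<lambda>_. 0" f n undefined] f0 by (simp add: R_const)
  thus "0 \<le> \<Lambda> f" using LIMSEQ_le_const[OF R_tendsto[OF f]] by blast
next
  have "(\<lambda>n. R n (\<lambda>_. 1) undefined) \<longlonglongrightarrow> \<Lambda> (\<lambda>_. 1)" by (rule R_tendsto) simp
  thus "\<Lambda> (\<lambda>_. 1) = 1" unfolding R_const by (simp add: LIMSEQ_const_iff)
qed

definition ev :: real where "ev = \<Lambda> (L (\<lambda>_. 1))"

text \<open>\<open>R n (L f)\<close> is \<open>R (Suc n) f\<close> times the ratio of
  \<open>u (Suc n)\<close> to \<open>u n\<close>, and that ratio is \<open>R n\<close> of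
  \<open>L\<close> applied to 1, which converges to \<open>ev\<close>.\<close>

lemma \<Lambda>_L:
  assumes f: "continuous_on UNIV f" shows "\<Lambda> (L f) = ev * \<Lambda> f"
proof -
  have "R n (L f) x = R n (L (\<lambda>_. 1)) x * R (Suc n) f x" for n x
    using u_neq_0[of "Suc n" x] by (simp only: R_def Lp_Suc[symmetric]) (simp del: funpow.simps)
  moreover have "(\<lambda>n. R n (L (\<lambda>_. 1)) undefined * R (Suc n) f undefined) \<longlonglongrightarrow> ev * \<Lambda> f"
    unfolding ev_def by (intro tendsto_mult LIMSEQ_Suc R_tendsto f continuous_L continuous_on_const)
  ultimately have "(\<lambda>n. R n (L f) undefined) \<longlonglongrightarrow> ev * \<Lambda> f" by simp
  thus ?thesis using R_tendsto[OF continuous_L[OF f]] LIMSEQ_unique by blast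
qed

lemma ev_pos [simp]: "0 < ev"
proof -
  obtain x0 where x0: "\<And>y. L (\<lambda>_. 1) x0 \<le> L (\<lambda>_. 1) y"
    using continuous_attains_inf[OF compact_space, of "L (\<lambda>_. 1)"] continuous_L[of "\<lambda>_. 1"] by auto
  have "0 < L (\<lambda>_. 1) x0" using u_pos[of 1 x0] by simp
  also have "\<dots> = \<Lambda> (\<lambda>_. L (\<lambda>_. 1) x0)" by (simp add: functional.const)
  also have "\<dots> \<le> ev" unfolding ev_def
    by (intro functional.mono continuous_on_const continuous_L x0)
  finally show ?thesis .
qed

lemma ev_neq_0 [simp]: "ev \<noteq> 0"
  using ev_pos by linarith

lemma ev_power_nonneg [simp]: "0 \<le> ev ^ n"
  using ev_pos by (intro zero_le_power less_imp_le)

lemma \<Lambda>_Lp: "continuous_on UNIV f \<Longrightarrow> \<Lambda> (Lp n f) = ev ^ n * \<Lambda> f"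
  by (induction n) (simp_all add: \<Lambda>_L continuous_Lp)

text \<open>A bound at a single \<open>n\<close> survives in the limit. In this way the functional
  at a varying parameter can be estimated from one fixed iterate, where the dependence on the
  parameter is explicit.\<close>

lemma \<Lambda>_abs_le_of_Lp:
  assumes f: "continuous_on UNIV f" and le: "\<And>x. \<bar>Lp n f x\<bar> \<le> c * u n x"
  shows "\<bar>\<Lambda> f\<bar> \<le> c"
proof -
  have R: "\<bar>R n f x\<bar> \<le> c" for x using le[of x] by (simp add: R_def pos_divide_le_eq)
  have "\<bar>R m f x\<bar> \<le> c" if "m \<ge> n" for m x using R_average[of n f 0 c "m - n" x] R that by simp
  moreover have "(\<lambda>m. \<bar>R m f undefined\<bar>) \<longlonglongrightarrow> \<bar>\<Lambda> f\<bar>" by (intro tendsto_intros R_tendsto f)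
  ultimately show ?thesis by (intro LIMSEQ_le_const2[of "\<lambda>m. \<bar>R m f undefined\<bar>"]) auto
qed

section \<open>Normalised iterates and the eigenfunction\<close>

definition v :: "nat \<Rightarrow> 'a \<Rightarrow> real" where "v n x = u n x / ev ^ n"

definition h :: "'a \<Rightarrow> real" where "h x = lim (\<lambda>n. v n x)"

lemma continuous_v: "continuous_on UNIV (v n)"
  unfolding v_def by (intro continuous_intros continuous_u) simp

lemma \<Lambda>_v: "\<Lambda> (v n) = 1"
proof -
  have "\<Lambda> (\<lambda>x. (1 / ev ^ n) * u n x) = (1 / ev ^ n) * \<Lambda> (u n)" by (rule functional.scale[OF continuous_u])
  also have "\<dots> = 1" by (simp add: \<Lambda>_Lp functional.one)
  finally show ?thesis by (simp add: v_def[abs_def])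
qed

text \<open>By the Harnack inequality all values of \<open>v n\<close> are comparable, and
  \<open>\<Lambda> (v n) = 1\<close> forces their common size to be of order 1.\<close>

lemma v_bounded: "\<exists>M\<ge>1. \<forall>n x. v n x \<le> M \<and> 1 / M \<le> v n x"
proof -
  obtain M where M: "M \<ge> 1" "\<And>n x y. u n x \<le> M * u n y" using u_ratio_bounded by blast
  have vM: "v n x \<le> M * v n y" for n x y
    using divide_right_mono[OF M(2)[of n x y], of "ev ^ n"] by (simp add: v_def)
  have "v n x \<le> M" for n x
  proof -
    have "\<Lambda> (\<lambda>_. v n x) \<le> \<Lambda> (\<lambda>y. M * v n y)" by (intro functional.mono continuous_intros continuous_v vM)
    thus ?thesis by (simp add: functional.scale continuous_v \<Lambda>_v functional.const)
  qed
  moreover have "1 / M \<le> v n x" for n x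
  proof -
    have "\<Lambda> (v n) \<le> \<Lambda> (\<lambda>y. M * v n x)" by (intro functional.mono continuous_intros continuous_v vM)
    thus ?thesis using M(1) by (simp add: functional.const \<Lambda>_v field_simps)
  qed
  ultimately show ?thesis using M(1) by blast
qed

lemma v_equicontinuous: "\<exists>M. equicontinuous_bounded (range v) M"
proof -
  obtain M where M: "M \<ge> 1" "\<And>n x. v n x \<le> M" "\<And>n x. 1 / M \<le> v n x" using v_bounded by blast
  have v0: "0 \<le> v n x" for n x using M(1) M(3)[of n x] by (meson divide_nonneg_nonneg order_trans zero_le_one)
  have "\<exists>\<delta>>0. \<forall>n x y. dist x y < \<delta> \<longrightarrow> \<bar>v n x - v n y\<bar> \<le> e" if e: "0 < e" for e
  proof -
    \<comment> \<open>Chosen so that exp \<epsilon> - 1 = e/M, which turns the multiplicative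
      distortion of functions bounded by \<open>M\<close> into the additive error
      \<open>e\<close>.\<close>
    define \<epsilon> where "\<epsilon> = ln (1 + e / M)"
    have \<epsilon>: "0 < \<epsilon>" "exp \<epsilon> = 1 + e / M" using e M(1) by (auto simp: \<epsilon>_def add_pos_pos)
    obtain \<delta> where \<delta>: "\<delta> > 0" "\<And>n x y. dist x y < \<delta> \<Longrightarrow> u n x \<le> exp \<epsilon> * u n y"
      using u_distortion[OF \<epsilon>(1)] by blast
    have le: "v n x - v n y \<le> e" if "dist x y < \<delta>" for n x y
    proof -
      have "v n x \<le> exp \<epsilon> * v n y" using divide_right_mono[OF \<delta>(2)[OF that, of n], of "ev ^ n"] by (simp add: v_def)
      hence "v n x - v n y \<le> e / M * v n y" by (simp add: \<epsilon>(2) algebra_simps)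
      also have "\<dots> \<le> e / M * M" using M e by (intro mult_left_mono) auto
      finally show ?thesis using M(1) by simp
    qed
    have "\<bar>v n x - v n y\<bar> \<le> e" if "dist x y < \<delta>" for n x y
      using le[OF that, of n] le[of y x n] that by (simp add: dist_commute abs_le_iff)
    thus ?thesis using \<delta>(1) by blast
  qed
  moreover have "\<bar>v n x\<bar> \<le> M" for n x using M(2)[of n x] v0[of n x] by simp
  ultimately have "equicontinuous_bounded (range v) M" by (simp add: equicontinuous_bounded_def)
  thus ?thesis ..
qed

text \<open>The second factor tends to \<open>\<Lambda> (v m) = 1\<close> as \<open>n\<close> grows,
  uniformly in \<open>m\<close>, so \<open>v\<close> is uniformly Cauchy.\<close>

lemma v_add: "v (n + m) x = v n x * R n (v m) x"
proof -
  have "u (n + m) x = Lp n (u m) x" by (simp add: Lp_comp)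
  also have "\<dots> = Lp n (\<lambda>x. ev ^ m * v m x) x" by (simp add: v_def)
  also have "\<dots> = ev ^ m * (R n (v m) x * u n x)" by (simp only: Lp_scale Lp_R[symmetric])
  finally show ?thesis by (simp add: v_def power_add)
qed

lemma v_uniform_limit: "uniform_limit UNIV v h sequentially"
proof -
  obtain M where M: "M \<ge> 1" "\<And>n x. v n x \<le> M" "\<And>n x. 1 / M \<le> v n x" using v_bounded by blast
  have v0: "0 \<le> v n x" for n x using M(1) M(3)[of n x] by (meson divide_nonneg_nonneg order_trans zero_le_one)
  obtain B where B: "equicontinuous_bounded (range v) B" using v_equicontinuous ..
  have close: "\<exists>N0. \<forall>n\<ge>N0. \<forall>m x. \<bar>v (n + m) x - v n x\<bar> \<le> e" if e: "0 < e" for e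
  proof -
    have "0 < e / M" using e M(1) by simp
    from R_uniform_limit[OF B this]
    obtain N0 where N0: "\<And>n m x. n \<ge> N0 \<Longrightarrow> \<bar>R n (v m) x - 1\<bar> \<le> e / M" by (auto simp: \<Lambda>_v)
    have "\<bar>v (n + m) x - v n x\<bar> \<le> e" if "n \<ge> N0" for n m x
    proof -
      have "v (n + m) x - v n x = v n x * (R n (v m) x - 1)" unfolding v_add by (simp add: right_diff_distrib)
      hence "\<bar>v (n + m) x - v n x\<bar> = v n x * \<bar>R n (v m) x - 1\<bar>" using v0 by (simp add: abs_mult)
      also have "\<dots> \<le> M * (e / M)" using M(1) by (intro mult_mono M(2) N0 that) auto
      finally show ?thesis using M(1) by simp
    qed
    thus ?thesis by blast
  qed
  have "uniformly_Cauchy_on UNIV v"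
    unfolding uniformly_Cauchy_on_def
  proof (intro allI impI)
    fix e :: real assume e: "0 < e"
    hence "0 < e / 4" by simp
    from close[OF this] obtain N0 where N0: "\<And>n m x. n \<ge> N0 \<Longrightarrow> \<bar>v (n + m) x - v n x\<bar> \<le> e / 4" by blast
    have "dist (v m x) (v n x) < e" if "m \<ge> N0" "n \<ge> N0" for m n x
    proof -
      have "\<bar>v m x - v N0 x\<bar> \<le> e / 4" "\<bar>v n x - v N0 x\<bar> \<le> e / 4"
        using N0[of N0 "m - N0" x] N0[of N0 "n - N0" x] that by simp_all
      thus ?thesis using e unfolding dist_real_def by linarith
    qed
    thus "\<exists>M. \<forall>x\<in>UNIV. \<forall>m\<ge>M. \<forall>n\<ge>M. dist (v m x) (v n x) < e" by blast
  qed
  hence "uniformly_convergent_on UNIV v" by (rule Cauchy_uniformly_convergent)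
  then obtain l where l: "uniform_limit UNIV v l sequentially" by (auto simp: uniformly_convergent_on_def)
  have "l = h"
  proof
    show "l x = h x" for x
      using tendsto_uniform_limitI[OF l, of x] unfolding h_def by (simp add: limI)
  qed
  thus ?thesis using l by simp
qed

lemma v_tendsto: "(\<lambda>n. v n x) \<longlonglongrightarrow> h x"
  using tendsto_uniform_limitI[OF v_uniform_limit] by simp

lemma continuous_h: "continuous_on UNIV h"
  by (rule uniform_limit_theorem[OF _ v_uniform_limit]) (auto simp: continuous_v)

lemma h_pos: "0 < h x"
proof -
  obtain M where M: "M \<ge> 1" "\<And>n x. 1 / M \<le> v n x" using v_bounded by blast
  have "1 / M \<le> h x" by (rule LIMSEQ_le_const[OF v_tendsto]) (use M in auto)
  thus ?thesis using M(1) by (meson divide_pos_pos less_le_trans less_le_trans zero_less_one)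
qed

lemma L_h: "L h x = ev * h x"
proof -
  have "L (v n) x = ev * v (Suc n) x" for n
  proof -
    have "L (\<lambda>x. (1 / ev ^ n) * u n x) x = (1 / ev ^ n) * L (u n) x"
      using Lp_scale[of 1 "1 / ev ^ n" "u n" x] by simp
    thus ?thesis by (simp add: v_def[abs_def])
  qed
  moreover have "(\<lambda>n. L (v n) x) \<longlonglongrightarrow> L h x"
    unfolding transfer_op_def by (intro tendsto_intros v_tendsto)
  ultimately have "(\<lambda>n. ev * v (Suc n) x) \<longlonglongrightarrow> L h x" by simp
  moreover have "(\<lambda>n. ev * v (Suc n) x) \<longlonglongrightarrow> ev * h x"
    by (intro tendsto_intros LIMSEQ_Suc v_tendsto)
  ultimately show ?thesis by (rule LIMSEQ_unique)
qed

lemma \<Lambda>_h: "\<Lambda> h = 1"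
proof -
  have "(\<lambda>n. \<Lambda> (v n)) \<longlonglongrightarrow> \<Lambda> h"
  proof (rule LIMSEQ_I)
    fix e :: real assume e: "0 < e"
    hence "0 < e / 2" by simp
    then obtain N0 where N0: "\<And>n x. n \<ge> N0 \<Longrightarrow> dist (v n x) (h x) < e / 2"
      using v_uniform_limit unfolding uniform_limit_iff eventually_sequentially by blast
    have "norm (\<Lambda> (v n) - \<Lambda> h) < e" if "n \<ge> N0" for n
    proof -
      have "\<bar>\<Lambda> (\<lambda>x. v n x - h x)\<bar> \<le> e / 2"
        using N0[OF that] by (intro functional.abs_le continuous_intros continuous_v continuous_h)
          (simp add: dist_real_def less_imp_le)
      thus ?thesis using e by (simp add: functional.diff continuous_v continuous_h)
    qed
    thus "\<exists>no. \<forall>n\<ge>no. norm (\<Lambda> (v n) - \<Lambda> h) < e" by blast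
  qed
  thus ?thesis by (simp add: \<Lambda>_v LIMSEQ_const_iff)
qed

section \<open>Identification of pressure, eigenmeasure and eigenfunction\<close>

lemma pressure_limit: "(\<lambda>n. 1 / real n * ln (u n z)) \<longlonglongrightarrow> ln ev"
proof -
  \<comment> \<open>\<open>u n\<close> is \<open>ev ^ n\<close> times \<open>v n\<close>, and
    \<open>ln (v n z)\<close> stays bounded because \<open>v n z\<close> converges to the positive
    number \<open>h z\<close>; division by \<open>n\<close> removes it.\<close>
  have "(\<lambda>n. 1 / real n * ln (v n z) + ln ev) \<longlonglongrightarrow> 0 * ln (h z) + ln ev"
    using h_pos[of z] by (intro tendsto_intros lim_1_over_n v_tendsto) auto
  moreover have "\<forall>\<^sub>F n in sequentially. 1 / real n * ln (v n z) + ln ev = 1 / real n * ln (u n z)"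
    using eventually_gt_at_top[of 0]
    by eventually_elim (simp add: v_def ln_div ln_realpow field_simps)
  ultimately show ?thesis by (simp add: filterlim_cong)
qed

lemma The_pressure: "(THE p. \<forall>z. (\<lambda>n. 1 / real n * ln (u n z)) \<longlonglongrightarrow> p) = ln ev"
proof (rule the_equality)
  show "\<forall>z. (\<lambda>n. 1 / real n * ln (u n z)) \<longlonglongrightarrow> ln ev" by (intro allI pressure_limit)
next
  fix p assume "\<forall>z. (\<lambda>n. 1 / real n * ln (u n z)) \<longlonglongrightarrow> p"
  hence "(\<lambda>n. 1 / real n * ln (u n undefined)) \<longlonglongrightarrow> p" ..
  thus "p = ln ev" using pressure_limit by (rule LIMSEQ_unique)
qed

lemma integrable_continuous:
  assumes "prob_space m" "sets m = sets borel" "continuous_on UNIV (f :: 'a \<Rightarrow> real)"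
  shows "integrable m f"
proof -
  interpret prob_space m by fact
  obtain B where "\<forall>x. \<bar>f x\<bar> \<le> B" using bounded_continuous[OF assms(3)] by blast
  moreover have "f \<in> borel_measurable m"
    using borel_measurable_continuous_onI[OF assms(3)] assms(2) by (simp cong: measurable_cong_sets)
  ultimately show ?thesis by (intro integrable_const_bound[where B=B]) auto
qed

text \<open>Integrating the n-th iterate of \<open>f\<close> minus c times \<open>u n\<close> gives
  \<open>ev ^ n\<close> times the defect to be estimated. The integrand is at most e times
  \<open>u n\<close> in modulus, and \<open>u n\<close> integrates to \<open>ev ^ n\<close>, so the
  powers cancel.\<close>

lemma integral_eigenmeasure_unique:
  assumes m: "prob_space m" "sets m = sets borel"
    and eigen: "\<And>f. continuous_on UNIV f \<Longrightarrow> (\<integral>x. L f x \<partial>m) = ev * (\<integral>x. f x \<partial>m)"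
    and f: "continuous_on UNIV f"
  shows "(\<integral>x. f x \<partial>m) = \<Lambda> f"
proof -
  interpret prob_space m by fact
  note int = integrable_continuous[OF m]
  have eigen_n: "(\<integral>x. Lp n g x \<partial>m) = ev ^ n * (\<integral>x. g x \<partial>m)" if "continuous_on UNIV g" for n g
    by (induction n) (simp_all add: eigen continuous_Lp that)
  define c where "c = \<Lambda> f"
  have "\<bar>(\<integral>x. f x \<partial>m) - c\<bar> \<le> 0 + e" if "0 < e" for e
  proof -
    from R_uniform[OF f that] obtain n where n: "\<And>x. \<bar>R n f x - c\<bar> \<le> e" by (auto simp: c_def)
    have ptw: "\<bar>Lp n f x - c * u n x\<bar> \<le> e * u n x" for x
    proof -
      have "Lp n f x - c * u n x = (R n f x - c) * u n x" by (simp add: R_def left_diff_distrib)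
      thus ?thesis using mult_right_mono[OF n[of x], of "u n x"] by (simp add: abs_mult)
    qed
    have i1: "integrable m (Lp n f)" "integrable m (u n)" by (intro int continuous_Lp f continuous_u)+
    have iu: "(\<integral>x. u n x \<partial>m) = ev ^ n" using eigen_n[of "\<lambda>_. 1" n] by (simp add: prob_space)
    have "\<bar>\<integral>x. Lp n f x - c * u n x \<partial>m\<bar> \<le> (\<integral>x. \<bar>Lp n f x - c * u n x\<bar> \<partial>m)" by (rule integral_abs_bound)
    also have "\<dots> \<le> (\<integral>x. e * u n x \<partial>m)"
      using i1 ptw by (intro integral_mono) auto
    also have "\<dots> = e * ev ^ n" using i1 iu by simp
    also have "(\<integral>x. Lp n f x - c * u n x \<partial>m) = ev ^ n * ((\<integral>x. f x \<partial>m) - c)"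
      using i1 iu eigen_n[OF f, of n] by (simp add: algebra_simps)
    finally have "ev ^ n * \<bar>(\<integral>x. f x \<partial>m) - c\<bar> \<le> ev ^ n * e"
      by (simp add: abs_mult mult.commute)
    thus ?thesis by (simp add: mult_le_cancel_left_pos)
  qed
  hence "\<bar>(\<integral>x. f x \<partial>m) - c\<bar> \<le> 0" by (rule field_le_epsilon)
  thus ?thesis by (simp add: c_def)
qed

lemma The_eigenmeasure:
  "(THE m. prob_space m \<and> sets m = sets borel \<and> (\<forall>f::'a \<Rightarrow> real. continuous_on UNIV f \<longrightarrow>
     (\<integral>x. L f x \<partial>m) = ev * (\<integral>x. f x \<partial>m))) = functional.representing_measure"
proof (rule the_equality, intro conjI allI impI)
  show "prob_space functional.representing_measure" by (rule functional.prob_space_representing_measure)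
  show "sets functional.representing_measure = sets borel" by (rule functional.sets_representing_measure)
  show "(\<integral>x. L f x \<partial>functional.representing_measure) = ev * (\<integral>x. f x \<partial>functional.representing_measure)"
    if "continuous_on UNIV f" for f
    using that by (simp add: functional.integral_representing_measure continuous_L \<Lambda>_L)
next
  fix m :: "'a measure"
  assume m: "prob_space m \<and> sets m = sets borel \<and> (\<forall>f::'a \<Rightarrow> real. continuous_on UNIV f \<longrightarrow>
     (\<integral>x. L f x \<partial>m) = ev * (\<integral>x. f x \<partial>m))"
  show "m = functional.representing_measure"
  proof (rule borel_prob_eqI)
    fix f :: "'a \<Rightarrow> real" assume "continuous_on UNIV f"
    moreover from this have "(\<integral>x. f x \<partial>m) = \<Lambda> f"
      using m by (intro integral_eigenmeasure_unique) auto
    ultimately show "(\<integral>x. f x \<partial>m) = (\<integral>x. f x \<partial>functional.representing_measure)"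
      by (simp add: functional.integral_representing_measure)
  qed (use m functional.prob_space_representing_measure functional.sets_representing_measure in blast)+
qed

text \<open>For an eigenfunction \<open>g\<close>, the product of \<open>R n g\<close> and
  \<open>v n\<close> equals \<open>g\<close> for every \<open>n\<close>, while it converges to
  \<open>\<Lambda> g\<close> times \<open>h\<close>. The normalisation then gives g = h.\<close>

lemma The_eigenfunction:
  "(THE g. continuous_on UNIV g \<and> (\<forall>x. 0 < g x) \<and> (\<forall>x. L g x = ev * g x) \<and>
     (\<integral>x. g x \<partial>functional.representing_measure) = 1) = h"
proof (rule the_equality)
  fix g assume g: "continuous_on UNIV g \<and> (\<forall>x. 0 < g x) \<and> (\<forall>x. L g x = ev * g x) \<and>
     (\<integral>x. g x \<partial>functional.representing_measure) = 1"
  hence gc: "continuous_on UNIV g" and Lg: "L g = (\<lambda>x. ev * g x)" and "\<Lambda> g = 1"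
    by (auto simp: functional.integral_representing_measure)
  have Lpg: "Lp n g x = ev ^ n * g x" for n x
  proof (induction n arbitrary: x)
    case (Suc n)
    have "Lp (Suc n) g x = ev * Lp n g x" unfolding Lp_Suc Lg by (rule Lp_scale)
    thus ?case by (simp add: Suc.IH)
  qed simp
  show "g = h"
  proof
    fix x
    have "R n g x * v n x = g x" for n by (simp add: R_def v_def Lpg)
    moreover have "(\<lambda>n. R n g x * v n x) \<longlonglongrightarrow> \<Lambda> g * h x"
      by (intro tendsto_mult R_tendsto gc v_tendsto)
    ultimately show "g x = h x" using \<open>\<Lambda> g = 1\<close> by (simp add: LIMSEQ_const_iff)
  qed
qed (simp add: continuous_h h_pos L_h functional.integral_representing_measure \<Lambda>_h)

lemma integral_equilibrium:
  assumes "continuous_on UNIV (f :: 'a \<Rightarrow> real)"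
  shows "(\<integral>x. f x \<partial>density functional.representing_measure (\<lambda>x. ennreal (h x))) = \<Lambda> (\<lambda>x. h x * f x)"
proof -
  have [measurable]: "f \<in> borel_measurable borel" "h \<in> borel_measurable borel"
    using borel_measurable_continuous_onI assms continuous_h by blast+
  have "(\<integral>x. f x \<partial>density functional.representing_measure (\<lambda>x. ennreal (h x))) =
     (\<integral>x. h x * f x \<partial>functional.representing_measure)"
    by (subst integral_real_density) (auto simp: h_pos less_imp_le)
  also have "\<dots> = \<Lambda> (\<lambda>x. h x * f x)"
    by (intro functional.integral_representing_measure continuous_intros continuous_h assms)
  finally show ?thesis .
qed

end

section \<open>Dependence on the parameter\<close>

lemma birkhoff_sum_scale: "birkhoff_sum T (\<lambda>y. s * b y) n x = s * birkhoff_sum T b n x"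
  by (simp add: birkhoff_sum_def sum_distrib_left)

text \<open>One verification, for the logarithm of \<open>J\<close>, serves all real
  parameters.\<close>

lemma (in ruelle_operator) scaled: "ruelle_operator T (\<lambda>y. s * b y)"
proof
  show "continuous_on UNIV (\<lambda>y. s * b y)" by (intro continuous_intros continuous_potential)
  fix \<epsilon> :: real assume \<epsilon>: "0 < \<epsilon>"
  \<comment> \<open>The summand 1 covers s = 0 and also gives
    \<open>\<epsilon>' \<le> \<epsilon>\<close>, which the distances of matched points
    require.\<close>
  define \<epsilon>' where "\<epsilon>' = \<epsilon> / (\<bar>s\<bar> + 1)"
  have \<epsilon>': "0 < \<epsilon>'" "\<epsilon>' \<le> \<epsilon>" "\<bar>s\<bar> * \<epsilon>' < \<epsilon>"
    using \<epsilon> by (auto simp: \<epsilon>'_def field_simps add_pos_nonneg)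
  have scale: "\<bar>birkhoff_sum T (\<lambda>y. s * b y) n w - birkhoff_sum T (\<lambda>y. s * b y) n w'\<bar> < \<epsilon>"
    if "\<bar>S n w - S n w'\<bar> < \<epsilon>'" for n w w'
  proof -
    have "\<bar>birkhoff_sum T (\<lambda>y. s * b y) n w - birkhoff_sum T (\<lambda>y. s * b y) n w'\<bar> = \<bar>s\<bar> * \<bar>S n w - S n w'\<bar>"
      unfolding birkhoff_sum_scale right_diff_distrib[symmetric] abs_mult ..
    also have "\<dots> \<le> \<bar>s\<bar> * \<epsilon>'" using that by (intro mult_left_mono) auto
    finally show ?thesis using \<epsilon>'(3) by linarith
  qed
  show "\<exists>\<delta>>0. \<forall>n x y. dist x y < \<delta> \<longrightarrow> (\<exists>g. bij_betw g (fibre T n x) (fibre T n y) \<and>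
        (\<forall>u\<in>fibre T n x. dist u (g u) < \<epsilon> \<and>
          \<bar>birkhoff_sum T (\<lambda>y. s * b y) n u - birkhoff_sum T (\<lambda>y. s * b y) n (g u)\<bar> < \<epsilon>))"
  proof -
    obtain \<delta> where \<delta>: "\<delta> > 0" and m: "\<And>n x y. dist x y < \<delta> \<Longrightarrow>
      (\<exists>g. bij_betw g (fibre T n x) (fibre T n y) \<and>
        (\<forall>u\<in>fibre T n x. dist u (g u) < \<epsilon>' \<and> \<bar>S n u - S n (g u)\<bar> < \<epsilon>'))"
      using matching[OF \<epsilon>'(1)] by blast
    show ?thesis
    proof (intro exI[of _ \<delta>] conjI allI impI \<delta>)
      fix n and x y :: 'a assume "dist x y < \<delta>"
      from m[OF this, of n] obtain g where g: "bij_betw g (fibre T n x) (fibre T n y)"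
        "\<And>w. w \<in> fibre T n x \<Longrightarrow> dist w (g w) < \<epsilon>'"
        "\<And>w. w \<in> fibre T n x \<Longrightarrow> \<bar>S n w - S n (g w)\<bar> < \<epsilon>'" by blast
      have "dist w (g w) < \<epsilon>" if "w \<in> fibre T n x" for w
        using g(2)[OF that] \<epsilon>'(2) by linarith
      thus "\<exists>g. bij_betw g (fibre T n x) (fibre T n y) \<and>
        (\<forall>u\<in>fibre T n x. dist u (g u) < \<epsilon> \<and>
          \<bar>birkhoff_sum T (\<lambda>y. s * b y) n u - birkhoff_sum T (\<lambda>y. s * b y) n (g u)\<bar> < \<epsilon>)"
        using g(1) scale[OF g(3)] by blast
    qed
  qed
qed (use compact_space finite_preimages dense_orbits in auto)

lemma abs_exp_minus_one_le:
  fixes x K :: real assumes "\<bar>x\<bar> \<le> K" shows "\<bar>exp x - 1\<bar> \<le> exp K - 1"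
proof -
  have "exp x \<le> exp K" using assms by simp
  moreover have "1 - exp x \<le> exp K - 1"
  proof -
    have "2 \<le> exp K + exp (- K)" using exp_ge_add_one_self[of K] exp_ge_add_one_self[of "-K"] by linarith
    moreover have "exp (- K) \<le> exp x" using assms by simp
    ultimately show ?thesis by linarith
  qed
  ultimately show ?thesis by (simp add: abs_le_iff)
qed

lemma abs_exp_taylor_le:
  fixes x :: real assumes "\<bar>x\<bar> \<le> 1" shows "\<bar>exp x - 1 - x\<bar> \<le> x\<^sup>2"
proof -
  have "exp x \<le> 1 + x + x\<^sup>2"
  proof (cases "0 \<le> x")
    case True thus ?thesis using exp_bound[of x] assms by simp
  next
    case False
    define y where "y = - x"
    have y: "0 < y" using False by (simp add: y_def)
    \<comment> \<open>The product is 1 + y^3.\<close>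
    have "1 \<le> (1 + y) * (1 - y + y\<^sup>2)" using y by (simp add: algebra_simps power2_eq_square)
    also have "\<dots> \<le> exp y * (1 - y + y\<^sup>2)"
    proof (rule mult_right_mono)
      show "1 + y \<le> exp y" by (rule exp_ge_add_one_self)
      show "0 \<le> 1 - y + y\<^sup>2" using assms by (simp add: y_def)
    qed
    finally have "exp (- y) \<le> 1 - y + y\<^sup>2" by (simp add: exp_minus field_simps)
    thus ?thesis by (simp add: y_def)
  qed
  moreover have "1 + x \<le> exp x" by (rule exp_ge_add_one_self)
  moreover have "0 \<le> x\<^sup>2" by simp
  ultimately show ?thesis by linarith
qed

text \<open>The fibres do not depend on the parameter, only the weights do. An \<open>n\<close> that
  is good at \<open>s\<close> is kept fixed, and for \<open>t\<close> close to \<open>s\<close> each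
  of the weights changes by a factor close to 1; no uniform speed of convergence near
  \<open>s\<close> is involved.\<close>

lemma \<Lambda>_tendsto_parameter:
  assumes "ruelle_operator T b" and f: "continuous_on UNIV f"
  shows "((\<lambda>t. ruelle_operator.\<Lambda> T (\<lambda>y. t * b y) f) \<longlongrightarrow> ruelle_operator.\<Lambda> T (\<lambda>y. s * b y) f) (at s)"
proof (rule tendstoI)
  fix e :: real assume e: "0 < e"
  interpret b: ruelle_operator T b by fact
  interpret s: ruelle_operator T "\<lambda>y. s * b y" by (rule b.scaled)
  define c where "c = s.\<Lambda> f"
  define g where "g = (\<lambda>x. f x - c)"
  have gc: "continuous_on UNIV g" unfolding g_def by (intro continuous_intros f)
  obtain G where G: "G > 0" "\<And>x. \<bar>g x\<bar> \<le> G" using s.bounded_continuous[OF gc] by blast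
  have "0 < e / 2" using e by simp
  from s.R_uniform[OF f this] obtain n where n: "\<And>x. \<bar>s.R n f x - c\<bar> \<le> e / 2" unfolding c_def by blast
  have gs: "\<bar>s.Lp n g x\<bar> \<le> e / 2 * s.u n x" for x
  proof -
    have "s.Lp n g x = s.Lp n f x - c * s.u n x"
      unfolding g_def s.Lp_diff using s.Lp_scale[of n c "\<lambda>_. 1" x] by simp
    also have "\<dots> = (s.R n f x - c) * s.u n x" by (simp add: s.R_def left_diff_distrib)
    finally show ?thesis using mult_right_mono[OF n[of x], of "s.u n x"] by (simp add: abs_mult)
  qed
  obtain B where B: "B > 0" "\<And>n x. \<bar>b.S n x\<bar> \<le> real n * B" using b.S_bound by blast
  define K where "K = real n * B"
  \<comment> \<open>Two errors occur: the summand with \<open>G\<close> comes from exchanging the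
    weights at \<open>s\<close> for those at \<open>t\<close> in the iterate of \<open>g\<close>,
    the outer factor from passing from \<open>s.u n\<close> to \<open>u n\<close> at
    \<open>t\<close>. The constant \<open>K\<close> bounds the Birkhoff sums of length
    \<open>n\<close>.\<close>
  have bound: "\<bar>ruelle_operator.\<Lambda> T (\<lambda>y. t * b y) f - c\<bar> \<le>
      (e / 2 + (exp (\<bar>t - s\<bar> * K) - 1) * G) * exp (\<bar>t - s\<bar> * K)" for t
  proof -
    interpret t: ruelle_operator T "\<lambda>y. t * b y" by (rule b.scaled)
    define \<eta> where "\<eta> = exp (\<bar>t - s\<bar> * K)"
    have "(t - s) * b.S n w \<le> \<bar>t - s\<bar> * K" "(s - t) * b.S n w \<le> \<bar>t - s\<bar> * K"
      and K: "\<bar>(t - s) * b.S n w\<bar> \<le> \<bar>t - s\<bar> * K" for w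
    proof -
      show K: "\<bar>(t - s) * b.S n w\<bar> \<le> \<bar>t - s\<bar> * K"
        unfolding abs_mult K_def by (intro mult_left_mono B) auto
      show "(t - s) * b.S n w \<le> \<bar>t - s\<bar> * K" "(s - t) * b.S n w \<le> \<bar>t - s\<bar> * K"
        using abs_le_D1[OF K] abs_le_D2[OF K] by (simp_all add: algebra_simps)
    qed
    note K' = this
    have wst: "\<bar>exp (t * b.S n w) - exp (s * b.S n w)\<bar> \<le> (\<eta> - 1) * exp (s * b.S n w)" for w
    proof -
      have "exp (t * b.S n w) - exp (s * b.S n w) = (exp ((t - s) * b.S n w) - 1) * exp (s * b.S n w)"
        by (simp add: left_diff_distrib exp_diff)
      thus ?thesis unfolding \<eta>_def using abs_exp_minus_one_le[OF K, of w]
        by (simp add: abs_mult)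
    qed
    have ust: "s.u n x \<le> \<eta> * t.u n x" for x
      unfolding s.Lp_eq t.Lp_eq sum_distrib_left birkhoff_sum_scale
    proof (rule sum_mono)
      fix w
      have "exp (s * b.S n w) \<le> exp (\<bar>t - s\<bar> * K + t * b.S n w)"
        using K'(2)[of w] by (simp add: algebra_simps)
      thus "exp (s * b.S n w) * 1 \<le> \<eta> * (exp (t * b.S n w) * 1)" by (simp add: exp_add \<eta>_def)
    qed
    have \<eta>: "1 \<le> \<eta>" using B(1) by (simp add: \<eta>_def K_def)
    have "\<bar>t.Lp n g x\<bar> \<le> (e / 2 + (\<eta> - 1) * G) * \<eta> * t.u n x" for x
    proof -
      have "\<bar>t.Lp n g x - s.Lp n g x\<bar> = \<bar>\<Sum>w\<in>fibre T n x. (exp (t * b.S n w) - exp (s * b.S n w)) * g w\<bar>"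
        by (simp add: s.Lp_eq t.Lp_eq birkhoff_sum_scale sum_subtractf left_diff_distrib)
      also have "\<dots> \<le> (\<Sum>w\<in>fibre T n x. \<bar>(exp (t * b.S n w) - exp (s * b.S n w)) * g w\<bar>)" by (rule sum_abs)
      also have "\<dots> \<le> (\<Sum>w\<in>fibre T n x. ((\<eta> - 1) * exp (s * b.S n w)) * G)"
        unfolding abs_mult using \<eta> by (intro sum_mono mult_mono wst G(2)) auto
      also have "\<dots> = (\<eta> - 1) * G * s.u n x"
        by (simp add: s.Lp_eq birkhoff_sum_scale sum_distrib_left mult_ac)
      finally have "\<bar>t.Lp n g x\<bar> \<le> e / 2 * s.u n x + (\<eta> - 1) * G * s.u n x" using gs[of x] by linarith
      also have "\<dots> = (e / 2 + (\<eta> - 1) * G) * s.u n x" by (simp add: algebra_simps)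
      also have "\<dots> \<le> (e / 2 + (\<eta> - 1) * G) * (\<eta> * t.u n x)"
        using e \<eta> G(1) by (intro mult_left_mono ust) auto
      finally show ?thesis by (simp add: mult_ac)
    qed
    hence "\<bar>t.\<Lambda> g\<bar> \<le> (e / 2 + (\<eta> - 1) * G) * \<eta>" by (rule t.\<Lambda>_abs_le_of_Lp[OF gc])
    moreover have "t.\<Lambda> g = t.\<Lambda> f - c" unfolding g_def by (simp add: t.functional.diff f t.functional.const)
    ultimately show ?thesis by (simp add: \<eta>_def)
  qed
  have "((\<lambda>t. (e / 2 + (exp (\<bar>t - s\<bar> * K) - 1) * G) * exp (\<bar>t - s\<bar> * K)) \<longlongrightarrow> e / 2) (at s)"
    by (auto intro!: tendsto_eq_intros)
  hence "\<forall>\<^sub>F t in at s. (e / 2 + (exp (\<bar>t - s\<bar> * K) - 1) * G) * exp (\<bar>t - s\<bar> * K) < e"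
    by (rule order_tendstoD) (use e in simp)
  thus "\<forall>\<^sub>F t in at s. dist (ruelle_operator.\<Lambda> T (\<lambda>y. t * b y) f) (s.\<Lambda> f) < e"
    by eventually_elim (use bound in \<open>auto simp: dist_real_def c_def intro: le_less_trans\<close>)
qed

text \<open>Pairing the eigenfunction at \<open>s\<close> with the eigenmeasure at \<open>t\<close> gives
  \<open>(ev t - ev s) * \<Lambda>\<^sub>t h\<^sub>s = \<Lambda>\<^sub>t (L\<^sub>t h\<^sub>s - L\<^sub>s h\<^sub>s)\<close>, so only weak continuity of the eigenmeasures
  is needed, and no perturbation theory for the eigenfunctions.\<close>

lemma ev_has_derivative:
  assumes "ruelle_operator T b"
  shows "((\<lambda>t. ruelle_operator.ev T (\<lambda>y. t * b y)) has_real_derivative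
     ruelle_operator.ev T (\<lambda>y. s * b y) *
     ruelle_operator.\<Lambda> T (\<lambda>y. s * b y) (\<lambda>x. ruelle_operator.h T (\<lambda>y. s * b y) x * b x)) (at s)"
proof -
  interpret b: ruelle_operator T b by fact
  interpret s: ruelle_operator T "\<lambda>y. s * b y" by (rule b.scaled)
  let ?ev = "\<lambda>t. ruelle_operator.ev T (\<lambda>y. t * b y)"
  let ?\<Lambda> = "\<lambda>t. ruelle_operator.\<Lambda> T (\<lambda>y. t * b y)"
  obtain B where B: "B > 0" "\<And>x. \<bar>b x\<bar> \<le> B" using b.bounded_continuous[OF b.continuous_potential] by blast
  obtain H where H: "H > 0" "\<And>x. \<bar>s.h x\<bar> \<le> H" using s.bounded_continuous[OF s.continuous_h] by blast
  \<comment> \<open>The difference quotients \<open>q t\<close> converge uniformly to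
    \<open>p\<close>, and the functionals at \<open>t\<close> do not increase the sup norm. Hence
    weak continuity is applied to the fixed functions \<open>p\<close> and \<open>s.h\<close>
    only.\<close>
  define q where "q = (\<lambda>t x. (transfer_op T (\<lambda>y. t * b y) s.h x - s.L s.h x) / (t - s))"
  define p where "p = s.L (\<lambda>x. s.h x * b x)"
  have pc: "continuous_on UNIV p" unfolding p_def
    by (intro s.continuous_L continuous_intros s.continuous_h b.continuous_potential)
  \<comment> \<open>The Taylor remainder of exp is at most (t - s)^2 B^2; the remaining sum is
    \<open>s.L s.h\<close>, which equals \<open>s.ev\<close> times \<open>s.h\<close> and is bounded
    by \<open>s.ev * H\<close>.\<close>
  define C where "C = B\<^sup>2 * (s.ev * H)"
  have quotient: "(?ev t - ?ev s) / (t - s) = ?\<Lambda> t (q t) / ?\<Lambda> t s.h"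
    and close: "\<bar>t - s\<bar> * B \<le> 1 \<Longrightarrow> \<bar>?\<Lambda> t (q t) - ?\<Lambda> t p\<bar> \<le> \<bar>t - s\<bar> * C" if ts: "t \<noteq> s" for t
  proof -
    interpret t: ruelle_operator T "\<lambda>y. t * b y" by (rule b.scaled)
    have "t.\<Lambda> (\<lambda>_. 0) < t.\<Lambda> s.h"
    proof -
      obtain x0 where x0: "\<And>y. s.h x0 \<le> s.h y"
        using continuous_attains_inf[OF s.compact_space _ s.continuous_h] by auto
      have "0 < s.h x0" by (rule s.h_pos)
      also have "s.h x0 = t.\<Lambda> (\<lambda>_. s.h x0)" by (simp add: t.functional.const)
      also have "\<dots> \<le> t.\<Lambda> s.h" by (intro t.functional.mono continuous_on_const s.continuous_h x0)
      finally show ?thesis by (simp add: t.functional.const)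
    qed
    hence \<Lambda>h: "t.\<Lambda> s.h > 0" by (simp add: t.functional.const)
    have qc: "continuous_on UNIV (q t)" unfolding q_def
      using ts by (intro continuous_intros t.continuous_L s.continuous_L s.continuous_h) auto
    have "t.\<Lambda> (\<lambda>x. (t - s) * q t x) = t.\<Lambda> (\<lambda>x. t.L s.h x - s.ev * s.h x)"
      using ts by (simp add: q_def s.L_h)
    hence "(t - s) * t.\<Lambda> (q t) = t.ev * t.\<Lambda> s.h - s.ev * t.\<Lambda> s.h"
      by (simp add: t.functional.scale qc t.functional.diff t.continuous_L s.continuous_h t.\<Lambda>_L
        continuous_on_mult_left)
    thus "(?ev t - ?ev s) / (t - s) = ?\<Lambda> t (q t) / ?\<Lambda> t s.h"
      using \<Lambda>h ts by (simp add: field_simps)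
    assume small: "\<bar>t - s\<bar> * B \<le> 1"
    have "\<bar>q t x - p x\<bar> \<le> \<bar>t - s\<bar> * C" for x
    proof -
      have eq: "(t - s) * (q t x - p x) =
          (\<Sum>y\<in>{y. T y = x}. exp (s * b y) * s.h y * (exp ((t - s) * b y) - 1 - (t - s) * b y))"
      proof -
        have "(t - s) * (q t x - p x) = transfer_op T (\<lambda>y. t * b y) s.h x - s.L s.h x - (t - s) * p x"
          unfolding right_diff_distrib q_def using ts by simp
        also have "\<dots> = (\<Sum>y\<in>{y. T y = x}. exp (t * b y) * s.h y - exp (s * b y) * s.h y
            - (t - s) * (exp (s * b y) * (s.h y * b y)))"
          by (simp add: p_def transfer_op_def sum_subtractf sum_distrib_left)
        also have "\<dots> = (\<Sum>y\<in>{y. T y = x}. exp (s * b y) * s.h y * (exp ((t - s) * b y) - 1 - (t - s) * b y))"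
        proof (intro sum.cong refl)
          fix y
          have "exp (t * b y) = exp (s * b y) * exp ((t - s) * b y)"
            by (simp add: exp_add[symmetric] algebra_simps)
          thus "exp (t * b y) * s.h y - exp (s * b y) * s.h y - (t - s) * (exp (s * b y) * (s.h y * b y)) =
            exp (s * b y) * s.h y * (exp ((t - s) * b y) - 1 - (t - s) * b y)"
            by (simp add: algebra_simps)
        qed
        finally show ?thesis .
      qed
      have "\<bar>(t - s) * (q t x - p x)\<bar> \<le>
         (\<Sum>y\<in>{y. T y = x}. \<bar>exp (s * b y) * s.h y * (exp ((t - s) * b y) - 1 - (t - s) * b y)\<bar>)"
        unfolding eq by (rule sum_abs)
      also have "\<dots> \<le> (\<Sum>y\<in>{y. T y = x}. exp (s * b y) * s.h y * ((t - s)\<^sup>2 * B\<^sup>2))"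
      proof (rule sum_mono)
        fix y
        have le: "\<bar>(t - s) * b y\<bar> \<le> \<bar>t - s\<bar> * B" unfolding abs_mult by (intro mult_left_mono B) auto
        hence "\<bar>exp ((t - s) * b y) - 1 - (t - s) * b y\<bar> \<le> ((t - s) * b y)\<^sup>2"
          using small by (intro abs_exp_taylor_le) linarith
        also have "\<dots> \<le> (t - s)\<^sup>2 * B\<^sup>2"
          unfolding power_mult_distrib using B(2)[of y] B(1) by (intro mult_left_mono) (auto simp: abs_le_square_iff[symmetric])
        finally show "\<bar>exp (s * b y) * s.h y * (exp ((t - s) * b y) - 1 - (t - s) * b y)\<bar> \<le>
          exp (s * b y) * s.h y * ((t - s)\<^sup>2 * B\<^sup>2)"
          using s.h_pos[of y] by (simp add: abs_mult)
      qed
      also have "\<dots> = s.L s.h x * ((t - s)\<^sup>2 * B\<^sup>2)" by (simp add: transfer_op_def sum_distrib_right)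
      also have "\<dots> \<le> (s.ev * H) * ((t - s)\<^sup>2 * B\<^sup>2)"
        unfolding s.L_h using abs_le_D1[OF H(2)[of x]] less_imp_le[OF s.ev_pos] by (intro mult_right_mono mult_left_mono) auto
      also have "\<dots> = \<bar>t - s\<bar> * (\<bar>t - s\<bar> * C)"
        by (simp add: C_def power2_eq_square mult_ac)
      finally show ?thesis using ts by (simp add: abs_mult)
    qed
    hence "\<bar>t.\<Lambda> (\<lambda>x. q t x - p x)\<bar> \<le> \<bar>t - s\<bar> * C"
      by (intro t.functional.abs_le continuous_intros qc pc)
    thus "\<bar>?\<Lambda> t (q t) - ?\<Lambda> t p\<bar> \<le> \<bar>t - s\<bar> * C" by (simp add: t.functional.diff qc pc)
  qed
  have "((\<lambda>t. \<bar>t - s\<bar> * B) \<longlongrightarrow> 0) (at s)" by (auto intro!: tendsto_eq_intros)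
  hence "\<forall>\<^sub>F t in at s. \<bar>t - s\<bar> * B < 1" by (rule order_tendstoD) simp
  hence "\<forall>\<^sub>F t in at s. norm (?\<Lambda> t (q t) - ?\<Lambda> t p) \<le> \<bar>t - s\<bar> * C"
    using eventually_neq_at_within[of s s UNIV] by eventually_elim (use close in auto)
  moreover have "((\<lambda>t. \<bar>t - s\<bar> * C) \<longlongrightarrow> 0) (at s)" by (auto intro!: tendsto_eq_intros)
  ultimately have "((\<lambda>t. ?\<Lambda> t (q t) - ?\<Lambda> t p) \<longlongrightarrow> 0) (at s)"
    by (rule Lim_null_comparison)
  from tendsto_add[OF this \<Lambda>_tendsto_parameter[OF assms pc]]
  have "((\<lambda>t. ?\<Lambda> t (q t)) \<longlongrightarrow> s.\<Lambda> p) (at s)" by simp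
  hence "((\<lambda>t. ?\<Lambda> t (q t) / ?\<Lambda> t s.h) \<longlongrightarrow> s.\<Lambda> p / s.\<Lambda> s.h) (at s)"
    by (intro tendsto_divide \<Lambda>_tendsto_parameter[OF assms] s.continuous_h) (simp_all add: s.\<Lambda>_h)
  moreover have "s.\<Lambda> p / s.\<Lambda> s.h = s.ev * s.\<Lambda> (\<lambda>x. s.h x * b x)"
    unfolding p_def s.\<Lambda>_h
    by (subst s.\<Lambda>_L) (auto intro!: continuous_intros s.continuous_h b.continuous_potential)
  moreover have "\<forall>\<^sub>F t in at s. ?\<Lambda> t (q t) / ?\<Lambda> t s.h = (?ev t - ?ev s) / (t - s)"
    using eventually_neq_at_within[of s s UNIV] by eventually_elim (use quotient in auto)
  ultimately show ?thesis
    unfolding has_field_derivative_iff by (simp add: filterlim_cong)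
qed

lemma pressure_has_derivative:
  fixes T :: "'a::metric_space \<Rightarrow> 'a"
  assumes op: "ruelle_operator T (\<lambda>x. ln (J x))"
  shows "(pressure T J has_real_derivative
            (\<integral>x. ln (J x) \<partial>(equilibrium_measure T J s))) (at s)"
proof -
  let ?b = "\<lambda>s y. s * ln (J y)"
  have op': "ruelle_operator T (?b t)" for t by (rule ruelle_operator.scaled[OF op])
  have P: "pressure T J t = ln (ruelle_operator.ev T (?b t))" for t
    unfolding pressure_def using ruelle_operator.The_pressure[OF op'] .
  interpret s: ruelle_operator T "?b s" by (rule op')
  have m: "eigenmeasure T J s = s.functional.representing_measure"
    unfolding eigenmeasure_def P using s.The_eigenmeasure by simp
  have h: "eigenfunction T J s = s.h"
    unfolding eigenfunction_def P m using s.The_eigenfunction by simp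
  have "(\<integral>x. ln (J x) \<partial>(equilibrium_measure T J s)) = s.\<Lambda> (\<lambda>x. s.h x * ln (J x))"
    unfolding equilibrium_measure_def m h
    by (rule s.integral_equilibrium[OF ruelle_operator.continuous_potential[OF op]])
  moreover have "((\<lambda>t. ln (ruelle_operator.ev T (?b t))) has_real_derivative
      inverse s.ev * (s.ev * s.\<Lambda> (\<lambda>x. s.h x * ln (J x)))) (at s)"
    by (rule DERIV_chain2[OF DERIV_ln[OF s.ev_pos] ev_has_derivative[OF op]])
  moreover have "pressure T J = (\<lambda>t. ln (ruelle_operator.ev T (?b t)))" using P by auto
  ultimately show ?thesis by (simp add: mult.assoc[symmetric])
qed

section \<open>Expanding and expansive maps\<close>

text \<open>The tracking clause of expansiveness with its radius exposed and detached from the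
  conditions on \<open>c\<close>, so that the expanding case can supply it as well.\<close>

definition unique_tracking :: "('a::metric_space \<Rightarrow> 'a) \<Rightarrow> (nat \<Rightarrow> real \<Rightarrow> real) \<Rightarrow> real \<Rightarrow> bool" where
  "unique_tracking T c r \<longleftrightarrow> (\<forall>n\<ge>1. \<forall>x y x'. dist x y < r \<and> (T ^^ n) x' = x \<longrightarrow>
     (\<exists>!y'. (T ^^ n) y' = y \<and> (\<forall>k\<le>n. dist ((T ^^ k) x') ((T ^^ k) y') \<le> c (n - k) (dist x y))))"

lemma unique_tracking_mono:
  assumes "unique_tracking T c r" "r' \<le> r" shows "unique_tracking T c r'"
  unfolding unique_tracking_def
proof (intro allI impI)
  fix n x y x' assume "1 \<le> n" "dist x y < r' \<and> (T ^^ n) x' = x"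
  hence "1 \<le> n" "dist x y < r \<and> (T ^^ n) x' = x" using assms(2) by auto
  thus "\<exists>!y'. (T ^^ n) y' = y \<and> (\<forall>k\<le>n. dist ((T ^^ k) x') ((T ^^ k) y') \<le> c (n - k) (dist x y))"
    using assms(1) unfolding unique_tracking_def by blast
qed

lemma all_le_Suc_iff: "(\<forall>k\<le>Suc n. P k) \<longleftrightarrow> P 0 \<and> (\<forall>k\<le>n. P (Suc k))"
  by (metis Suc_le_mono le0 not0_implies_Suc)

text \<open>Induction that adds a step at the beginning of the orbit: the orbit of
  \<open>T x'\<close> is tracked first, then its starting point is pulled back once. Uniqueness
  persists because the bound for the new point is below l r, the radius in which preimages are
  unique.\<close>

lemma unique_tracking_expanding:
  fixes T :: "'a::metric_space \<Rightarrow> 'a"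
  assumes l: "0 < l" "l < 1" and "0 < r"
    and step: "\<And>x y x'. dist x y < r \<Longrightarrow> T x' = x \<Longrightarrow> \<exists>!y'. T y' = y \<and> dist x' y' < l * r"
    and contr: "\<And>x y x' y'. dist x y < r \<Longrightarrow> T x' = x \<Longrightarrow> T y' = y \<Longrightarrow> dist x' y' < l * r \<Longrightarrow>
      dist x' y' \<le> l * dist x y"
  shows "unique_tracking T (\<lambda>n t. l ^ n * t) r"
proof -
  have "\<exists>!y'. (T ^^ n) y' = y \<and> (\<forall>k\<le>n. dist ((T ^^ k) x') ((T ^^ k) y') \<le> l ^ (n - k) * dist x y)"
    if "dist x y < r" "(T ^^ n) x' = x" for n x y x'
    using that
  proof (induction n arbitrary: x')
    case 0 thus ?case by (intro ex1I[of _ y]) auto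
  next
    case (Suc n)
    define Q where "Q = (\<lambda>y1. (T ^^ n) y1 = y \<and>
      (\<forall>k\<le>n. dist ((T ^^ k) (T x')) ((T ^^ k) y1) \<le> l ^ (n - k) * dist x y))"
    have "(T ^^ n) (T x') = x" using Suc.prems(2) by (simp add: funpow_swap1)
    hence "\<exists>!y1. Q y1" unfolding Q_def using Suc.IH[OF Suc.prems(1)] by blast
    then obtain y1 where y1: "Q y1" "\<And>z. Q z \<Longrightarrow> z = y1" by blast
    have ln: "l ^ n * dist x y \<le> dist x y" for n
      using l by (intro mult_left_le_one_le power_le_one) auto
    have d1: "dist (T x') y1 \<le> l ^ n * dist x y" using y1(1) unfolding Q_def by (auto dest!: spec[of _ 0])
    hence d1r: "dist (T x') y1 < r" using ln[of n] Suc.prems(1) by linarith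
    obtain y2 where y2: "T y2 = y1" "dist x' y2 < l * r" "\<And>z. T z = y1 \<Longrightarrow> dist x' z < l * r \<Longrightarrow> z = y2"
      using step[OF d1r refl] by blast
    have "dist x' y2 \<le> l * dist (T x') y1" using contr[OF d1r refl y2(1,2)] .
    also have "\<dots> \<le> l * (l ^ n * dist x y)" using d1 l by (intro mult_left_mono) auto
    finally have d2: "dist x' y2 \<le> l ^ Suc n * dist x y" by simp
    have eq: "(T ^^ Suc n) z = y \<and> (\<forall>k\<le>Suc n. dist ((T ^^ k) x') ((T ^^ k) z) \<le> l ^ (Suc n - k) * dist x y) \<longleftrightarrow>
      Q (T z) \<and> dist x' z \<le> l ^ Suc n * dist x y" for z
      unfolding all_le_Suc_iff Q_def funpow_Suc_right o_def by auto
    have "z = y2" if z: "Q (T z)" "dist x' z \<le> l ^ Suc n * dist x y" for z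
    proof (rule y2(3))
      show "T z = y1" using y1(2) z(1) .
      have "l ^ Suc n * dist x y \<le> l * dist x y" using ln[of n] l by simp
      also have "\<dots> < l * r" using Suc.prems(1) l by simp
      finally show "dist x' z < l * r" using z(2) by linarith
    qed
    thus ?case unfolding eq using y1(1) y2(1) d2 by (intro ex1I[of _ y2]) auto
  qed
  thus ?thesis unfolding unique_tracking_def by blast
qed

lemma bij_betw_of_unique:
  assumes "\<And>x. x \<in> A \<Longrightarrow> \<exists>!y. y \<in> B \<and> Q x y" "\<And>y. y \<in> B \<Longrightarrow> \<exists>!x. x \<in> A \<and> Q x y"
  shows "\<exists>g. bij_betw g A B \<and> (\<forall>x\<in>A. Q x (g x))"
proof -
  obtain g where g: "\<And>x. x \<in> A \<Longrightarrow> g x \<in> B \<and> Q x (g x)" using assms(1) by metis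
  have "inj_on g A" unfolding inj_on_def using g assms(2) by metis
  moreover have "B \<subseteq> g ` A"
  proof
    fix y assume y: "y \<in> B"
    then obtain x where x: "x \<in> A" "Q x y" using assms(2) by blast
    hence "g x = y" using assms(1)[OF x(1)] g[OF x(1)] y by blast
    thus "y \<in> g ` A" using x(1) by blast
  qed
  ultimately have "bij_betw g A B" using g unfolding bij_betw_def by blast
  thus ?thesis using g by blast
qed

text \<open>Being tracked is a symmetric relation, so unique tracking from \<open>x\<close> to
  \<open>y\<close> and from \<open>y\<close> to \<open>x\<close> makes it the graph of a bijection
  of the fibres.\<close>

lemma unique_tracking_matching:
  assumes "unique_tracking T c r" "1 \<le> n" "dist x y < r"
  shows "\<exists>g. bij_betw g (fibre T n x) (fibre T n y) \<and>
    (\<forall>w\<in>fibre T n x. \<forall>k\<le>n. dist ((T ^^ k) w) ((T ^^ k) (g w)) \<le> c (n - k) (dist x y))"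
proof (rule bij_betw_of_unique)
  show "\<exists>!z. z \<in> fibre T n y \<and> (\<forall>k\<le>n. dist ((T ^^ k) w) ((T ^^ k) z) \<le> c (n - k) (dist x y))"
    if "w \<in> fibre T n x" for w
  proof -
    have "(T ^^ n) w = x" using that by (simp add: fibre_def)
    hence "\<exists>!z. (T ^^ n) z = y \<and> (\<forall>k\<le>n. dist ((T ^^ k) w) ((T ^^ k) z) \<le> c (n - k) (dist x y))"
      using assms unfolding unique_tracking_def by blast
    thus ?thesis by (simp add: fibre_def)
  qed
  show "\<exists>!w. w \<in> fibre T n x \<and> (\<forall>k\<le>n. dist ((T ^^ k) w) ((T ^^ k) z) \<le> c (n - k) (dist x y))"
    if "z \<in> fibre T n y" for z
  proof -
    have "dist y x < r" "(T ^^ n) z = y" using assms(3) that by (simp_all add: dist_commute fibre_def)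
    hence "\<exists>!w. (T ^^ n) w = x \<and> (\<forall>k\<le>n. dist ((T ^^ k) z) ((T ^^ k) w) \<le> c (n - k) (dist y x))"
      using assms(1,2) unfolding unique_tracking_def by blast
    thus ?thesis by (simp add: fibre_def dist_commute)
  qed
qed

section \<open>Compactness: finite fibres and uniform mixing\<close>

lemma local_homeomorphism_finite_preimages:
  fixes T :: "'a::topological_space \<Rightarrow> 'b::topological_space"
  assumes "compact (UNIV :: 'a set)" "local_homeomorphism T"
  shows "finite {y. T y = x}"
proof -
  obtain U where U: "\<And>z. open (U z)" "\<And>z. z \<in> U z" "\<And>z. inj_on T (U z)"
    using assms(2) unfolding local_homeomorphism_def by (metis homeomorphism_apply1 inj_on_inverseI)
  have cover: "UNIV \<subseteq> (\<Union>z\<in>UNIV. U z)" using U(2) by blast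
  obtain D where D: "finite D" "UNIV \<subseteq> (\<Union>z\<in>D. U z)"
    by (rule compactE_image[OF assms(1) U(1) cover]) blast
  have "finite (U z \<inter> {y. T y = x})" for z
  proof (cases "\<exists>y. y \<in> U z \<and> T y = x")
    case True
    then obtain y where "y \<in> U z" "T y = x" by blast
    hence "U z \<inter> {y. T y = x} \<subseteq> {y}" using U(3)[of z] by (auto simp: inj_on_def)
    thus ?thesis by (rule finite_subset) simp
  next
    case False
    hence "U z \<inter> {y. T y = x} = {}" by blast
    thus ?thesis by simp
  qed
  hence "finite (\<Union>z\<in>D. U z \<inter> {y. T y = x})" using D(1) by blast
  moreover have "{y. T y = x} \<subseteq> (\<Union>z\<in>D. U z \<inter> {y. T y = x})" using D(2) by blast
  ultimately show ?thesis by (rule finite_subset[rotated])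
qed

text \<open>Finitely many balls of radius \<rho>/2 cover the space, and the largest of the mixing
  times of their pairs serves all pairs of points at the price of doubling the radius.\<close>

lemma mixing_uniform:
  fixes T :: "'a::metric_space \<Rightarrow> 'a"
  assumes "compact (UNIV :: 'a set)" "topologically_mixing T" "0 < \<rho>"
  shows "\<exists>k. \<forall>n>k. \<forall>x y. \<exists>w. dist w y < \<rho> \<and> dist ((T ^^ n) w) x < \<rho>"
proof -
  have cover: "UNIV \<subseteq> (\<Union>z\<in>UNIV. ball (z::'a) (\<rho>/2))"
  proof
    fix x :: 'a
    have "x \<in> ball x (\<rho>/2)" using assms(3) by simp
    thus "x \<in> (\<Union>z\<in>UNIV. ball z (\<rho>/2))" by blast
  qed
  obtain Z :: "'a set" where Z: "finite Z" "UNIV \<subseteq> (\<Union>z\<in>Z. ball z (\<rho>/2))"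
    by (rule compactE_image[OF assms(1) open_ball cover]) blast
  have "\<exists>k. \<forall>n>k. (T ^^ n) -` ball z1 (\<rho>/2) \<inter> ball z2 (\<rho>/2) \<noteq> {}" for z1 z2
    using assms(2,3) unfolding topologically_mixing_def by auto
  then obtain k where k: "\<And>z1 z2 n. n > k z1 z2 \<Longrightarrow> (T ^^ n) -` ball z1 (\<rho>/2) \<inter> ball z2 (\<rho>/2) \<noteq> {}" by metis
  define K where "K = Max ((\<lambda>(z1, z2). k z1 z2) ` (Z \<times> Z))"
  have "\<exists>w. dist w y < \<rho> \<and> dist ((T ^^ n) w) x < \<rho>" if n: "n > K" for n x y
  proof -
    have near: "\<exists>z\<in>Z. dist z x < \<rho>/2" for x
    proof -
      have "x \<in> (\<Union>z\<in>Z. ball z (\<rho>/2))" using Z(2) by (rule subsetD) simp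
      thus ?thesis by auto
    qed
    obtain z1 where z1: "z1 \<in> Z" "dist z1 x < \<rho>/2" using near by blast
    obtain z2 where z2: "z2 \<in> Z" "dist z2 y < \<rho>/2" using near by blast
    have "k z1 z2 \<le> K" unfolding K_def using Z(1) z1(1) z2(1) by (intro Max_ge) (auto intro!: image_eqI[of _ _ "(z1, z2)"])
    hence "(T ^^ n) -` ball z1 (\<rho>/2) \<inter> ball z2 (\<rho>/2) \<noteq> {}" using n by (intro k) simp
    then obtain w where w: "dist z1 ((T ^^ n) w) < \<rho>/2" "dist z2 w < \<rho>/2" by auto
    have "dist w y < \<rho>" using w(2) z2(2) dist_triangle[of w y z2] by (simp add: dist_commute)
    moreover have "dist ((T ^^ n) w) x < \<rho>"
      using w(1) z1(2) dist_triangle[of "(T ^^ n) w" x z1] by (simp add: dist_commute)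
    ultimately show ?thesis by blast
  qed
  thus ?thesis by blast
qed

lemma powr_tail_sum_small:
  fixes p \<epsilon> :: real
  assumes "1 < p" "0 < \<epsilon>"
  shows "\<exists>A0\<ge>0. \<forall>A\<ge>A0. \<forall>n. (\<Sum>j=1..n. (A + real j) powr (- p)) \<le> \<epsilon>"
proof -
  define f where "f = (\<lambda>j. real j powr (- p))"
  have f: "summable f" unfolding f_def using assms(1) by (simp add: summable_real_powr_iff)
  obtain N where N: "\<And>n. n \<ge> N \<Longrightarrow> norm (\<Sum>i. f (i + n)) < \<epsilon>" using suminf_exist_split[OF assms(2) f] by blast
  have "(\<Sum>j=1..n. (A + real j) powr (- p)) \<le> \<epsilon>" if "A \<ge> real N" for A n
  proof -
    have "(\<Sum>j=1..n. (A + real j) powr (- p)) \<le> (\<Sum>j=1..n. f (j + N))"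
      unfolding f_def using that assms(1) by (intro sum_mono powr_mono2') auto
    also have "\<dots> \<le> (\<Sum>i. f (i + N))"
      by (intro sum_le_suminf summable_ignore_initial_segment f) (auto simp: f_def)
    also have "\<dots> \<le> \<epsilon>" using N[of N] by simp
    finally show ?thesis .
  qed
  thus ?thesis by (intro exI[of _ "real N"]) auto
qed

text \<open>In both cases of the theorem, the variation of the potential along the \<open>j\<close>-th last step of a
  pair of tracking orbits ending at distance \<open>t\<close> is \<open>O ((A t + j) powr - p)\<close> with \<open>p > 1\<close> and
  \<open>A t\<close> tending to infinity as \<open>t\<close> tends to \<open>0\<close>: the total is a tail of a convergent series.\<close>

lemma ruelle_operatorI:
  fixes T :: "'a::metric_space \<Rightarrow> 'a" and A :: "real \<Rightarrow> real"
  assumes compact: "compact (UNIV :: 'a set)" and homeo: "local_homeomorphism T"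
    and mixing: "topologically_mixing T"
    and track: "unique_tracking T c r" and r: "0 < r" and C: "0 < C"
    and c0: "\<And>t. c 0 t = C * t" and cC: "\<And>n t. 0 \<le> t \<Longrightarrow> t < r \<Longrightarrow> c n t \<le> C * t"
    and c_small: "\<And>\<epsilon>. 0 < \<epsilon> \<Longrightarrow> \<exists>N. \<forall>n\<ge>N. \<forall>t. 0 \<le> t \<and> t < r \<longrightarrow> c n t < \<epsilon>"
    and K: "0 \<le> K" and p: "1 < p"
    and var: "\<And>j t z z'. 0 < t \<Longrightarrow> t < r \<Longrightarrow> dist z z' \<le> c j t \<Longrightarrow>
      \<bar>b z - b z'\<bar> \<le> K * (A t + real j) powr (- p)"
    and A: "\<And>A0. \<exists>\<delta>>0. \<forall>t. 0 < t \<and> t < \<delta> \<longrightarrow> A0 \<le> A t"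
  shows "ruelle_operator T b"
proof
  show "compact (UNIV :: 'a set)" by (rule compact)
  show "finite {y. T y = x}" for x by (rule local_homeomorphism_finite_preimages[OF compact homeo])
  have small: "\<exists>A0\<ge>0. \<forall>A\<ge>A0. \<forall>n. K * (\<Sum>j=1..n. (A + real j) powr (- p)) < \<epsilon>" if "0 < \<epsilon>" for \<epsilon>
  proof -
    define \<epsilon>' where "\<epsilon>' = \<epsilon> / (K + 1)"
    have \<epsilon>': "0 < \<epsilon>'" "K * \<epsilon>' < \<epsilon>" using that K by (auto simp: \<epsilon>'_def field_simps)
    obtain A0 where A0: "A0 \<ge> 0" "\<And>A n. A \<ge> A0 \<Longrightarrow> (\<Sum>j=1..n. (A + real j) powr (- p)) \<le> \<epsilon>'"
      using powr_tail_sum_small[OF p \<epsilon>'(1)] by blast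
    have "K * (\<Sum>j=1..n. (A + real j) powr (- p)) < \<epsilon>" if "A \<ge> A0" for A n
      using mult_left_mono[OF A0(2)[OF that, of n] K] \<epsilon>'(2) by linarith
    thus ?thesis using A0(1) by blast
  qed
  show "continuous_on UNIV b" unfolding continuous_on_iff
  proof (intro ballI allI impI)
    fix x :: 'a and e :: real assume "0 < e"
    from small[OF this] obtain A0 where
      A0: "\<And>A n. A \<ge> A0 \<Longrightarrow> K * (\<Sum>j=1..n. (A + real j) powr (- p)) < e" by blast
    obtain \<delta> where \<delta>: "\<delta> > 0" "\<And>t. 0 < t \<Longrightarrow> t < \<delta> \<Longrightarrow> A0 + 1 \<le> A t" using A[of "A0 + 1"] by blast
    have "dist (b z) (b x) < e" if z: "dist z x < C * min r \<delta>" for z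
    proof (cases "z = x")
      case True thus ?thesis using \<open>0 < e\<close> by simp
    next
      case False
      define t where "t = dist z x / C"
      have t: "0 < t" "t < r" "t < \<delta>" "dist z x \<le> c 0 t"
      proof -
        have "t < min r \<delta>" unfolding t_def pos_divide_less_eq[OF C] using z by (simp only: mult.commute)
        thus "t < r" "t < \<delta>" by simp_all
        show "0 < t" "dist z x \<le> c 0 t" using False C by (simp_all add: t_def c0)
      qed
      have "\<bar>b z - b x\<bar> \<le> K * (A t + real 0) powr (- p)" using var[OF t(1,2,4)] .
      \<comment> \<open>The single term at j = 0 is the one-term sum from j = 1 with
        \<open>A t - 1\<close> in place of \<open>A t\<close>; this is why the threshold was raised
        to \<open>A0 + 1\<close>.\<close>
      also have "\<dots> < e" using A0[of "A t - 1" 1] \<delta>(2)[OF t(1,3)] by simp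
      finally show ?thesis by (simp add: dist_real_def)
    qed
    thus "\<exists>d>0. \<forall>x'\<in>UNIV. dist x' x < d \<longrightarrow> dist (b x') (b x) < e"
      using C r \<delta>(1) by (intro exI[of _ "C * min r \<delta>"]) auto
  qed
  fix \<epsilon> :: real assume \<epsilon>: "0 < \<epsilon>"
  show "\<exists>N\<ge>1. \<forall>x y. \<exists>w\<in>fibre T N x. dist w y < \<epsilon>"
  proof -
    obtain N where N: "\<And>n t. n \<ge> N \<Longrightarrow> 0 \<le> t \<Longrightarrow> t < r \<Longrightarrow> c n t < \<epsilon>/2" using c_small[of "\<epsilon>/2"] \<epsilon> by auto
    have "0 < min r (\<epsilon>/2)" using r \<epsilon> by simp
    from mixing_uniform[OF compact mixing this]
    obtain k where k: "\<And>n x y. n > k \<Longrightarrow> \<exists>w. dist w y < min r (\<epsilon>/2) \<and> dist ((T ^^ n) w) x < min r (\<epsilon>/2)"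
      by blast
    define n where "n = max N (Suc k)"
    have n: "n \<ge> N" "n > k" "n \<ge> 1" by (auto simp: n_def)
    have "\<exists>w\<in>fibre T n x. dist w y < \<epsilon>" for x y
    proof -
      \<comment> \<open>Mixing hits the target \<open>x\<close> only approximately. Tracking then
        replaces \<open>w\<close> by a true preimage of \<open>x\<close> and moves it by less than
        \<epsilon>/2, since \<open>n\<close> is large.\<close>
      obtain w where w: "dist w y < min r (\<epsilon>/2)" "dist ((T ^^ n) w) x < min r (\<epsilon>/2)" using k[OF n(2)] by blast
      hence d: "dist ((T ^^ n) w) x < r" by simp
      obtain g where g: "bij_betw g (fibre T n ((T ^^ n) w)) (fibre T n x)"
        "\<And>z k. z \<in> fibre T n ((T ^^ n) w) \<Longrightarrow> k \<le> n \<Longrightarrow>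
           dist ((T ^^ k) z) ((T ^^ k) (g z)) \<le> c (n - k) (dist ((T ^^ n) w) x)"
        using unique_tracking_matching[OF track n(3) d] by blast
      have w': "w \<in> fibre T n ((T ^^ n) w)" by (simp add: fibre_def)
      have "dist w (g w) \<le> c n (dist ((T ^^ n) w) x)" using g(2)[OF w', of 0] by simp
      also have "\<dots> < \<epsilon>/2" by (rule N[OF n(1) zero_le_dist d])
      finally have "dist (g w) y < \<epsilon>"
        using w(1) dist_triangle[of "g w" y w] by (simp add: dist_commute)
      moreover have "g w \<in> fibre T n x" using bij_betwE[OF g(1)] w' by blast
      ultimately show ?thesis by blast
    qed
    thus ?thesis using n(3) by blast
  qed
  obtain A0 where A0: "\<And>A n. A \<ge> A0 \<Longrightarrow> K * (\<Sum>j=1..n. (A + real j) powr (- p)) < \<epsilon>" using small[OF \<epsilon>] by blast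
  obtain \<delta> where \<delta>: "\<delta> > 0" "\<And>t. 0 < t \<Longrightarrow> t < \<delta> \<Longrightarrow> A0 \<le> A t" using A[of A0] by blast
  have "\<exists>g. bij_betw g (fibre T n x) (fibre T n y) \<and>
        (\<forall>u\<in>fibre T n x. dist u (g u) < \<epsilon> \<and> \<bar>birkhoff_sum T b n u - birkhoff_sum T b n (g u)\<bar> < \<epsilon>)"
    if d: "dist x y < min (min r \<delta>) (min \<epsilon> (\<epsilon> / C))" for n x y
  proof -
    \<comment> \<open>Tracking is available for \<open>n \<ge> 1\<close> only, and the variation
      bound for positive distance only.\<close>
    consider "n = 0" | "x = y" | "n \<ge> 1" "x \<noteq> y" by linarith
    thus ?thesis
    proof cases
      case 1 thus ?thesis using d \<epsilon> by (intro exI[of _ "\<lambda>_. y"]) (auto simp: bij_betw_def birkhoff_sum_def)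
    next
      case 2 thus ?thesis using \<epsilon> by (intro exI[of _ "\<lambda>z. z"]) (auto simp: bij_betw_def)
    next
      case 3
      define t where "t = dist x y"
      have t: "0 < t" "t < r" "t < \<delta>" "C * t < \<epsilon>" using d 3 C by (auto simp: t_def field_simps)
      obtain g where g: "bij_betw g (fibre T n x) (fibre T n y)"
        "\<And>z k. z \<in> fibre T n x \<Longrightarrow> k \<le> n \<Longrightarrow> dist ((T ^^ k) z) ((T ^^ k) (g z)) \<le> c (n - k) t"
        using unique_tracking_matching[OF track 3(1), of x y] t unfolding t_def by blast
      have "dist w (g w) < \<epsilon> \<and> \<bar>birkhoff_sum T b n w - birkhoff_sum T b n (g w)\<bar> < \<epsilon>"
        if w: "w \<in> fibre T n x" for w
      proof
        have "dist w (g w) \<le> c n t" using g(2)[OF w, of 0] by simp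
        also have "\<dots> \<le> C * t" using t by (intro cC) auto
        finally show "dist w (g w) < \<epsilon>" using t(4) by linarith
        have "\<bar>birkhoff_sum T b n w - birkhoff_sum T b n (g w)\<bar> \<le>
          (\<Sum>k<n. \<bar>b ((T ^^ k) w) - b ((T ^^ k) (g w))\<bar>)"
          unfolding birkhoff_sum_def sum_subtractf[symmetric] by (rule sum_abs)
        also have "\<dots> \<le> (\<Sum>k<n. K * (A t + real (n - k)) powr (- p))"
          by (intro sum_mono var[OF t(1,2)] g(2)[OF w]) auto
        also have "\<dots> = (\<Sum>j=1..n. K * (A t + real j) powr (- p))"
          \<comment> \<open>With j = n - k counting the steps left, the Birkhoff sum omits k = n, so
            j runs from 1 to n.\<close>
          by (rule sum.reindex_bij_witness[of _ "\<lambda>j. n - j" "\<lambda>k. n - k"]) auto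
        also have "\<dots> < \<epsilon>" unfolding sum_distrib_left[symmetric] by (rule A0[OF \<delta>(2)[OF t(1,3)]])
        finally show "\<bar>birkhoff_sum T b n w - birkhoff_sum T b n (g w)\<bar> < \<epsilon>" .
      qed
      thus ?thesis using g(1) by blast
    qed
  qed
  moreover have "0 < min (min r \<delta>) (min \<epsilon> (\<epsilon> / C))" using r \<delta>(1) \<epsilon> C by simp
  ultimately show "\<exists>\<delta>>0. \<forall>n x y. dist x y < \<delta> \<longrightarrow> (\<exists>g. bij_betw g (fibre T n x) (fibre T n y) \<and>
        (\<forall>u\<in>fibre T n x. dist u (g u) < \<epsilon> \<and> \<bar>birkhoff_sum T b n u - birkhoff_sum T b n (g u)\<bar> < \<epsilon>))"
    by blast
qed

text \<open>After j backward steps distances are at most l^j t, so minus their logarithm grows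
  linearly in j with slope \<kappa> = - ln l. The logarithmic modulus turns this into a power of
  \<open>A t + j\<close>, with p = \<beta>.\<close>

lemma ruelle_operator_expanding:
  fixes T :: "'a::metric_space \<Rightarrow> 'a"
  assumes "compact (UNIV :: 'a set)" "local_homeomorphism T" "topologically_mixing T"
    and exp: "ruelle_expanding T" and \<beta>: "1 < \<beta>" and t0: "1 < t0"
    and b: "omega_hoelder (omega_log t0 0 \<beta>) b"
  shows "ruelle_operator T b"
proof -
  obtain l r0 where l: "0 < l" "l < 1" and r0: "0 < r0"
    and step: "\<And>x y x'. dist x y < r0 \<Longrightarrow> T x' = x \<Longrightarrow> \<exists>!y'. T y' = y \<and> dist x' y' < l * r0"
    and contr: "\<And>x y x' y'. dist x y < r0 \<Longrightarrow> T x' = x \<Longrightarrow> T y' = y \<Longrightarrow> dist x' y' < l * r0 \<Longrightarrow>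
      dist x' y' \<le> l * dist x y"
    using exp unfolding ruelle_expanding_def by blast
  obtain D where D: "\<And>x y. \<bar>b x - b y\<bar> \<le> D * omega_log t0 0 \<beta> (dist x y)"
    using b unfolding omega_hoelder_def by blast
  \<comment> \<open>Radius at most 1 makes ln t nonpositive, so that \<open>A t\<close> is
    positive.\<close>
  define r where "r = min r0 1"
  define \<kappa> where "\<kappa> = - ln l"
  have \<kappa>: "0 < \<kappa>" using l by (simp add: \<kappa>_def)
  define A where "A = (\<lambda>t. (ln t0 - ln t) / \<kappa>)"
  show ?thesis
  proof (rule ruelle_operatorI[where c="\<lambda>n t. l ^ n * t" and r=r and C=1 and A=A
        and K="\<bar>D\<bar> * \<kappa> powr (- \<beta>)" and p=\<beta>])
    show "unique_tracking T (\<lambda>n t. l ^ n * t) r"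
      by (rule unique_tracking_mono[OF unique_tracking_expanding[OF l r0 step contr]]) (auto simp: r_def)
    show "0 < r" using r0 by (simp add: r_def)
    have ln: "l ^ n * t \<le> t" if "0 \<le> t" for n t
      using l that by (intro mult_left_le_one_le power_le_one) auto
    thus "l ^ n * t \<le> 1 * t" if "0 \<le> t" "t < r" for n t using that by simp
    show "\<exists>N. \<forall>n\<ge>N. \<forall>t. 0 \<le> t \<and> t < r \<longrightarrow> l ^ n * t < \<epsilon>" if \<epsilon>: "0 < \<epsilon>" for \<epsilon>
    proof -
      obtain N where N: "l ^ N < \<epsilon>" using real_arch_pow_inv[OF \<epsilon> l(2)] by blast
      have "l ^ n * t < \<epsilon>" if "n \<ge> N" "0 \<le> t" "t < r" for n t
      proof -
        have "l ^ n * t \<le> l ^ n * 1" using l that by (intro mult_left_mono) (auto simp: r_def)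
        also have "\<dots> \<le> l ^ N" using l that(1) by (simp add: power_decreasing)
        finally show ?thesis using N by linarith
      qed
      thus ?thesis by blast
    qed
    show "\<bar>b z - b z'\<bar> \<le> \<bar>D\<bar> * \<kappa> powr (- \<beta>) * (A t + real j) powr (- \<beta>)"
      if t: "0 < t" "t < r" and d: "dist z z' \<le> l ^ j * t" for j t z z'
    proof (cases "z = z'")
      case True thus ?thesis by simp
    next
      case False
      have ln_t: "ln t \<le> 0" using t by (simp add: r_def)
      have lt0: "0 < ln t0" using t0 by simp
      have "ln (dist z z') \<le> ln (l ^ j * t)" using d False l t by (subst ln_le_cancel_iff) auto
      also have "\<dots> = real j * ln l + ln t" using l t by (simp add: ln_mult ln_realpow)
      finally have "ln (dist z z') \<le> real j * ln l + ln t" .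
      moreover have "\<kappa> * A t = ln t0 - ln t" using \<kappa> by (simp add: A_def)
      moreover have "\<kappa> * real j = - (real j * ln l)" by (simp add: \<kappa>_def)
      ultimately have le: "\<kappa> * (A t + real j) \<le> ln t0 - ln (dist z z')"
        unfolding distrib_left by linarith
      have A0: "0 < A t" using \<kappa> ln_t lt0 by (simp add: A_def)
      have "omega_log t0 0 \<beta> (dist z z') = (ln t0 - ln (dist z z')) powr (- \<beta>)"
        using False by (simp add: omega_log_def)
      also have "\<dots> \<le> (\<kappa> * (A t + real j)) powr (- \<beta>)"
        using le \<kappa> A0 \<beta> by (intro powr_mono2') auto
      also have "\<dots> = \<kappa> powr (- \<beta>) * (A t + real j) powr (- \<beta>)" using \<kappa> A0 by (simp add: powr_mult)
      finally have om: "omega_log t0 0 \<beta> (dist z z') \<le> \<kappa> powr (- \<beta>) * (A t + real j) powr (- \<beta>)" .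
      have "\<bar>b z - b z'\<bar> \<le> D * omega_log t0 0 \<beta> (dist z z')" by (rule D)
      also have "\<dots> \<le> \<bar>D\<bar> * omega_log t0 0 \<beta> (dist z z')"
        by (intro mult_right_mono) (auto simp: omega_log_def)
      also have "\<dots> \<le> \<bar>D\<bar> * (\<kappa> powr (- \<beta>) * (A t + real j) powr (- \<beta>))" by (intro mult_left_mono om) auto
      finally show ?thesis by (simp add: mult.assoc)
    qed
    show "\<exists>\<delta>>0. \<forall>t. 0 < t \<and> t < \<delta> \<longrightarrow> A0 \<le> A t" for A0
    proof (intro exI[of _ "exp (ln t0 - A0 * \<kappa>)"] conjI allI impI)
      fix t assume "0 < t \<and> t < exp (ln t0 - A0 * \<kappa>)"
      hence "ln t < ln t0 - A0 * \<kappa>" by (metis exp_ln exp_less_cancel_iff)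
      thus "A0 \<le> A t" using \<kappa> by (simp add: A_def pos_le_divide_eq)
    qed simp
  qed (use assms \<beta> in auto)
qed

text \<open>Pulling the factor t into the power rewrites the contraction rate as a constant times
  (t^(-1/\<beta>) + n)^(-\<beta>), which reveals \<open>A\<close>; the exponent \<alpha> of the
  modulus then gives p = \<alpha> \<beta>.\<close>

lemma ruelle_operator_expansive:
  fixes T :: "'a::metric_space \<Rightarrow> 'a"
  assumes "compact (UNIV :: 'a set)" "local_homeomorphism T" "topologically_mixing T"
    and exp: "ruelle_expansive T (\<lambda>n t. t * (1 + real n * t powr (1 / \<beta>)) powr (- \<beta>))"
    and \<beta>: "1 < \<beta>" and \<alpha>: "1 < \<alpha> * \<beta>"
    and b: "omega_hoelder (omega_log t0 \<alpha> 0) b"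
  shows "ruelle_operator T b"
proof -
  define c where "c = (\<lambda>C n t. C * (t * (1 + real n * t powr (1 / \<beta>)) powr (- \<beta>)))"
  obtain C r where C: "0 < C" and r: "0 < r" and track: "unique_tracking T (c C) r"
    using exp unfolding ruelle_expansive_def ruelle_expansive_exact_def unique_tracking_def c_def by blast
  obtain D where D: "\<And>x y. \<bar>b x - b y\<bar> \<le> D * omega_log t0 \<alpha> 0 (dist x y)"
    using b unfolding omega_hoelder_def by blast
  have \<alpha>0: "0 < \<alpha>" using \<alpha> \<beta> by (smt (verit) mult_nonpos_nonneg)
  define A where "A = (\<lambda>t::real. t powr (- (1 / \<beta>)))"
  have c_eq: "c C n t = C * (A t + real n) powr (- \<beta>)" if "0 < t" for n t
  proof -
    have "t = A t powr (- \<beta>)" using that \<beta> by (simp add: A_def powr_powr)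
    hence "t * (1 + real n * t powr (1 / \<beta>)) powr (- \<beta>) =
      A t powr (- \<beta>) * (1 + real n * t powr (1 / \<beta>)) powr (- \<beta>)" by simp
    also have "\<dots> = (A t * (1 + real n * t powr (1 / \<beta>))) powr (- \<beta>)"
      by (simp add: powr_mult A_def)
    also have "A t * (1 + real n * t powr (1 / \<beta>)) = A t + real n * (A t * t powr (1 / \<beta>))"
      by (simp add: algebra_simps)
    also have "A t * t powr (1 / \<beta>) = 1" using that by (simp add: A_def powr_add[symmetric])
    finally show ?thesis by (simp add: c_def)
  qed
  have A0: "0 < A t" if "0 < t" for t using that by (simp add: A_def)
  show ?thesis
  proof (rule ruelle_operatorI[where c="c C" and r=r and C=C and A=A
        and K="\<bar>D\<bar> * C powr \<alpha>" and p="\<alpha> * \<beta>"])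
    show "c C 0 t = C * t" for t by (simp add: c_def)
    show "c C n t \<le> C * t" if "0 \<le> t" "t < r" for n t
    proof -
      have "(1 + real n * t powr (1 / \<beta>)) powr (- \<beta>) \<le> 1 powr (- \<beta>)"
        using \<beta> by (intro powr_mono2') auto
      hence "t * (1 + real n * t powr (1 / \<beta>)) powr (- \<beta>) \<le> t * 1" using that by (intro mult_left_mono) auto
      thus ?thesis using C by (simp add: c_def)
    qed
    show "\<exists>N. \<forall>n\<ge>N. \<forall>t. 0 \<le> t \<and> t < r \<longrightarrow> c C n t < \<epsilon>" if \<epsilon>: "0 < \<epsilon>" for \<epsilon>
    proof -
      have "(\<lambda>n. C * real n powr (- \<beta>)) \<longlonglongrightarrow> C * 0"
        using \<beta> by (intro tendsto_intros tendsto_neg_powr filterlim_real_sequentially) auto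
      hence "\<forall>\<^sub>F n in sequentially. C * real n powr (- \<beta>) < \<epsilon>" by (rule order_tendstoD) (use \<epsilon> in simp)
      then obtain N where N: "\<And>n. n \<ge> N \<Longrightarrow> C * real n powr (- \<beta>) < \<epsilon>" by (auto simp: eventually_sequentially)
      \<comment> \<open>The successor keeps \<open>real n\<close> positive, as a base under a
        negative exponent must be for the monotonicity used here.\<close>
      have "c C n t < \<epsilon>" if n: "n \<ge> Suc N" and t: "0 \<le> t" for n t
      proof (cases "t = 0")
        case True thus ?thesis using \<epsilon> by (simp add: c_def)
      next
        case False
        hence "0 < t" using t by simp
        hence "c C n t \<le> C * real n powr (- \<beta>)"
          unfolding c_eq[OF \<open>0 < t\<close>] using A0[of t] n C \<beta> by (intro mult_left_mono powr_mono2') auto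
        thus ?thesis using N[of n] n by simp
      qed
      thus ?thesis by blast
    qed
    show "\<bar>b z - b z'\<bar> \<le> \<bar>D\<bar> * C powr \<alpha> * (A t + real j) powr (- (\<alpha> * \<beta>))"
      if t: "0 < t" "t < r" and d: "dist z z' \<le> c C j t" for j t z z'
    proof -
      \<comment> \<open>Only an inequality: the logarithmic factor to the power 0 is 1, except for
        base 0, where \<open>powr\<close> returns 0.\<close>
      have "omega_log t0 \<alpha> 0 (dist z z') \<le> dist z z' powr \<alpha>" by (simp add: omega_log_def)
      also have "\<dots> \<le> (C * (A t + real j) powr (- \<beta>)) powr \<alpha>"
        using d \<alpha>0 unfolding c_eq[OF t(1)] by (intro powr_mono2) auto
      also have "\<dots> = C powr \<alpha> * (A t + real j) powr (- (\<alpha> * \<beta>))"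
        using C by (simp add: powr_mult powr_powr mult.commute)
      finally have om: "omega_log t0 \<alpha> 0 (dist z z') \<le> C powr \<alpha> * (A t + real j) powr (- (\<alpha> * \<beta>))" .
      have "\<bar>b z - b z'\<bar> \<le> D * omega_log t0 \<alpha> 0 (dist z z')" by (rule D)
      also have "\<dots> \<le> \<bar>D\<bar> * omega_log t0 \<alpha> 0 (dist z z')"
        by (intro mult_right_mono) (auto simp: omega_log_def)
      also have "\<dots> \<le> \<bar>D\<bar> * (C powr \<alpha> * (A t + real j) powr (- (\<alpha> * \<beta>)))" by (intro mult_left_mono om) auto
      finally show ?thesis by (simp add: mult.assoc)
    qed
    show "\<exists>\<delta>>0. \<forall>t. 0 < t \<and> t < \<delta> \<longrightarrow> A0 \<le> A t" for A0
    \<comment> \<open>The point at which \<open>A\<close> takes the value \<open>max A0 1\<close>;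
      the maximum ensures a positive base.\<close>
    proof (intro exI[of _ "max A0 1 powr (- \<beta>)"] conjI allI impI)
      fix t assume t: "0 < t \<and> t < max A0 1 powr (- \<beta>)"
      have "max A0 1 = (max A0 1 powr (- \<beta>)) powr (- (1 / \<beta>))" using \<beta> by (simp add: powr_powr)
      also have "\<dots> \<le> A t" unfolding A_def using t \<beta> by (intro powr_mono2') auto
      finally show "A0 \<le> A t" by simp
    qed simp
  qed (use assms C r track in auto)
qed

theorem lemma4p5:
  fixes T :: "'a::metric_space \<Rightarrow> 'a"
    and J :: "'a \<Rightarrow> real"
    and \<alpha> \<beta> t0 s :: real
  assumes "compact (UNIV :: 'a set)"
    and "diameter (UNIV :: 'a set) = 1"
    and "\<forall>n\<ge>1. local_homeomorphism (T ^^ n)"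
    and "topologically_mixing T"
    and "\<forall>x. 0 < J x"
    and "\<beta> > 1"
    and "(ruelle_expanding T \<and>
            admissible_t0 t0 0 \<beta> \<and>
            omega_hoelder (omega_log t0 0 \<beta>) (\<lambda>x. ln (J x)))
       \<or> (ruelle_expansive T (\<lambda>n t. t * (1 + real n * t powr (1 / \<beta>)) powr (- \<beta>)) \<and>
            \<alpha> * \<beta> > 1 \<and>
            admissible_t0 t0 \<alpha> 0 \<and>
            omega_hoelder (omega_log t0 \<alpha> 0) (\<lambda>x. ln (J x)))"
  shows "(pressure T J has_real_derivative
            (\<integral>x. ln (J x) \<partial>(equilibrium_measure T J s))) (at s)"
proof (rule pressure_has_derivative)
  have homeo: "local_homeomorphism T" using assms(3)[rule_format, of 1] by simp
  show "ruelle_operator T (\<lambda>x. ln (J x))"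
    using assms(7)
  proof
    assume "ruelle_expanding T \<and> admissible_t0 t0 0 \<beta> \<and>
      omega_hoelder (omega_log t0 0 \<beta>) (\<lambda>x. ln (J x))"
    thus ?thesis
      using ruelle_operator_expanding[OF assms(1) homeo assms(4) _ assms(6), of t0]
      by (simp add: admissible_t0_def)
  next
    assume "ruelle_expansive T (\<lambda>n t. t * (1 + real n * t powr (1 / \<beta>)) powr (- \<beta>)) \<and>
      \<alpha> * \<beta> > 1 \<and> admissible_t0 t0 \<alpha> 0 \<and> omega_hoelder (omega_log t0 \<alpha> 0) (\<lambda>x. ln (J x))"
    thus ?thesis
      using ruelle_operator_expansive[OF assms(1) homeo assms(4) _ assms(6), of \<alpha> t0] by blast
  qed
qed

end
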